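(* Let $A,B\in\mathbb{Z}$ and let $\varphi:[A,B]\to\mathbb{R}^+$ be a positive convex function with Lipschitz constant $\kappa_\varphi$, and assume that a minimizer $x^*\in\arg\min_{x\in[A,B]}\varphi(x)$ can be efficiently computed. Then for any $K:=1+\epsilon$ with $\epsilon>0$, the algorithm ScaledCompressConv described in the context returns a canonical representation of a $K$-approximation set of $\varphi$ of size $O(\log_K\frac{\varphi^{\max}}{\varphi^{\min}})$, consisting of points whose domain and codomain values are representable in $O(\log\frac1\epsilon+\log\frac{\varphi^{\max}}{\varphi^{\min}}+\log\kappa_\varphi+\log|A|+\log|B|)$ space. The algorithm runs in $O(t_\varphi\log\frac{\kappa_\varphi(B-A)}{\epsilon\varphi^{\min}}\log_K\frac{\varphi^{\max}}{\varphi^{\min}})$ time.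
   Context: For $\varphi$ on a bounded domain, $\varphi^{\min}:=\min\{|\varphi(x)|:\varphi(x)\ne0\}$, $\varphi^{\max}:=\max|\varphi(x)|$, $t_\varphi$ bounds the time to evaluate $\varphi$ at a point. $\tilde\varphi$ is a $K$-approximation of $\varphi\ge0$ if $\varphi\le\tilde\varphi\le K\varphi$. For convex $\varphi$ and finite $E$, the convex extension induced by $E$ is the lower envelope of the convex hull of $\{(x,\varphi(x)):x\in E\}$ on $[\min E,\max E]$; $W$ is a $K$-approximation set of $\varphi$ if this extension induced by $W$ is a $K$-approximation of $\varphi$. A canonical representation is the sorted array of pairs (point, associated value). Algorithm ScaledCompressConvInc$(\varphi,[a,b],K=1+\epsilon)$ for a convex nondecreasing $\varphi$: with $s:=\frac{\epsilon^2\varphi^{\min}}{100\kappa_\varphi}$ and $\rho(x):=\frac{10\varphi(sx)}{\epsilon\varphi^{\min}}$ on $[a/s,b/s]$, start from the left endpoint, repeatedly find by binary search $y',y''$ with $\rho(y')\in[(1+\frac3{10}\epsilon)\rho(x),(1+\frac4{10}\epsilon)\rho(x)]$, $\rho(y'')\in[(1+\frac6{10}\epsilon)\rho(x),(1+\frac7{10}\epsilon)\rho(x)]$, take an integer $y\in[y',y'']$, record $(y,\lceil\rho(y)\rceil)$ and continue from $y$ while $(1+\epsilon)\rho(x)<\rho(b/s)$; the endpoints are recorded as $(\cdot,\lceil\rho(\cdot)\rceil)$; finally each recorded $(y,v)$ is rescaled to $(sy,\frac{\epsilon\varphi^{\min}}{10}v)$. ScaledCompressConvDec is the analogous routine for convex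 nonincreasing functions. Algorithm ScaledCompressConv$(\varphi,[A,B],K)$: compute $x^*$; $W_A:=$ScaledCompressConvDec$(\varphi,[A,x^*],K)$; $W_B:=$ScaledCompressConvInc$(\varphi,[x^*,B],K)$; return $(W_A\cup W_B)\setminus\{(x^*,\lceil\varphi(x^* )\rceil)\}$ sorted by first coordinate.
   Formalization: For ε > 20 there may be no integer in [y',y'']; there only completed runs are covered. If φ^max < 1, log(1/φ^max) is added to the space bound. The pair removed at x* is the recorded (rescaled) one, and it is kept when x* is A or B. *)

theory Defs
  imports "HOL-Analysis.Analysis" "HOL-Library.Log_Nat"
begin

section \<open>Approximation sets\<close>

definition phi_min :: "(real \<Rightarrow> real) \<Rightarrow> real set \<Rightarrow> real" where
  "phi_min \<phi> D = Inf {\<bar>\<phi> x\<bar> | x. x \<in> D \<and> \<phi> x \<noteq> 0}"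

definition phi_max :: "(real \<Rightarrow> real) \<Rightarrow> real set \<Rightarrow> real" where
  "phi_max \<phi> D = Sup ((\<lambda>x. \<bar>\<phi> x\<bar>) ` D)"

definition K_approximation :: "real \<Rightarrow> (real \<Rightarrow> real) \<Rightarrow> real set \<Rightarrow> (real \<Rightarrow> real) \<Rightarrow> bool" where
  "K_approximation K \<phi> D \<psi> \<longleftrightarrow> (\<forall>x\<in>D. \<phi> x \<le> \<psi> x \<and> \<psi> x \<le> K * \<phi> x)"

definition convex_extension :: "(real \<Rightarrow> real) \<Rightarrow> real set \<Rightarrow> real \<Rightarrow> real" where
  "convex_extension \<phi> E x = Inf {z. (x, z) \<in> convex hull ((\<lambda>e. (e, \<phi> e)) ` E)}"

text \<open>The extension induced by \<open>E\<close> lives on \<open>[Min E, Max E]\<close>, which therefore has to be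
  the whole domain of the approximated function.\<close>

definition K_approximation_set ::
    "real \<Rightarrow> (real \<Rightarrow> real) \<Rightarrow> real \<Rightarrow> real \<Rightarrow> real set \<Rightarrow> bool" where
  "K_approximation_set K \<phi> A B E \<longleftrightarrow>
     finite E \<and> E \<noteq> {} \<and> E \<subseteq> {A..B} \<and> Min E = A \<and> Max E = B \<and>
     K_approximation K \<phi> {A..B} (convex_extension \<phi> E)"

text \<open>The value associated with a point is in general a rounding of the function value;
  it is required to be a \<open>K\<close>-approximation of it.\<close>

definition canonical_representation ::
    "real \<Rightarrow> (real \<Rightarrow> real) \<Rightarrow> real set \<Rightarrow> (real \<times> real) list \<Rightarrow> bool" where
  "canonical_representation K \<phi> E R \<longleftrightarrow>
     sorted_wrt (<) (map fst R) \<and> fst ` set R = E \<and>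
     (\<forall>(x, v) \<in> set R. \<phi> x \<le> v \<and> v \<le> K * \<phi> x)"


section \<open>Programs with running time\<close>

text \<open>\<open>Some (x, t)\<close>: result \<open>x\<close> after \<open>t\<close> steps; \<open>None\<close>: the run diverges or gets stuck.
  An arithmetic operation or comparison on reals is a constant number of steps.\<close>

type_synonym 'a timed = "('a \<times> nat) option"

definition spend :: "nat \<Rightarrow> 'a \<Rightarrow> 'a timed" where
  "spend t x = Some (x, t)"

definition andthen :: "'a timed \<Rightarrow> ('a \<Rightarrow> 'b timed) \<Rightarrow> 'b timed"  (infixl \<open>\<triangleright>\<close> 54) where
  "p \<triangleright> q = Option.bind p (\<lambda>r. Option.bind (q (fst r)) (\<lambda>r'. Some (fst r', snd r + snd r')))"

lemma andthen_mono [partial_function_mono]: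
  assumes "mono_option P" and "\<And>x. mono_option (\<lambda>f. Q x f)"
  shows "mono_option (\<lambda>f. P f \<triangleright> (\<lambda>x. Q x f))"
  unfolding andthen_def
  by (intro bind_mono assms option.const_mono)


section \<open>The algorithm\<close>

text \<open>Binary search on \<open>[lo, hi]\<close> for a point whose \<open>f\<close>-value lies in \<open>[l, u]\<close>.\<close>

partial_function (option) bisect ::
    "(real \<Rightarrow> real timed) \<Rightarrow> real \<Rightarrow> real \<Rightarrow> real \<Rightarrow> real \<Rightarrow> real timed" where
  "bisect f l u lo hi =
     spend 1 ((lo + hi) / 2) \<triangleright> (\<lambda>mid.
     f mid \<triangleright> (\<lambda>r.
       if r < l then bisect f l u mid hi
       else if u < r then bisect f l u lo mid
       else spend 1 mid))"

text \<open>In \<open>compress_loop f pick \<epsilon> e re x rx\<close>, \<open>e\<close> is the right end of the scaled domain,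
  \<open>x\<close> the current point, \<open>re\<close> and \<open>rx\<close> are the values of \<open>f\<close> there. The function \<open>pick\<close>
  chooses the integer in \<open>[y', y'']\<close>; the run is stuck if there is none. The scaling only
  guarantees \<open>y'' - y' \<ge> 20 / \<epsilon>\<close>, so this can happen for \<open>\<epsilon> > 20\<close>.\<close>

definition picks_integer :: "(real \<Rightarrow> real \<Rightarrow> int) \<Rightarrow> bool" where
  "picks_integer pick \<longleftrightarrow>
     (\<forall>l u. (\<exists>k::int. l \<le> of_int k \<and> of_int k \<le> u) \<longrightarrow>
        l \<le> of_int (pick l u) \<and> of_int (pick l u) \<le> u)"

partial_function (option) compress_loop ::
    "(real \<Rightarrow> real timed) \<Rightarrow> (real \<Rightarrow> real \<Rightarrow> int) \<Rightarrow> real \<Rightarrow> real \<Rightarrow> real \<Rightarrow> real \<Rightarrow> real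
      \<Rightarrow> (real \<times> int) set timed" where
  "compress_loop f pick \<epsilon> e re x rx =
     spend 1 () \<triangleright> (\<lambda>_.
     if (1 + \<epsilon>) * rx < re then
       bisect f ((1 + 3/10 * \<epsilon>) * rx) ((1 + 4/10 * \<epsilon>) * rx) x e \<triangleright> (\<lambda>y'.
       bisect f ((1 + 6/10 * \<epsilon>) * rx) ((1 + 7/10 * \<epsilon>) * rx) x e \<triangleright> (\<lambda>y''.
       spend 1 (real_of_int (pick y' y'')) \<triangleright> (\<lambda>y.
       if y' \<le> y \<and> y \<le> y'' then
         f y \<triangleright> (\<lambda>ry.
         compress_loop f pick \<epsilon> e re y ry \<triangleright> (\<lambda>W.
         spend 1 (insert (y, \<lceil>ry\<rceil>) W)))
       else None)))
     else spend 1 {})"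

text \<open>\<open>\<tau> x\<close> is the time needed to evaluate \<open>\<phi>\<close> at \<open>x\<close>. As \<open>\<phi>\<close> is nondecreasing,
  \<open>phi_min \<phi> {a..b}\<close> is found by one evaluation at \<open>a\<close>.\<close>

definition scale_step :: "real \<Rightarrow> real \<Rightarrow> real \<Rightarrow> real" where
  "scale_step \<kappa> \<epsilon> m = \<epsilon>\<^sup>2 * m / (100 * \<kappa>)"

definition scaled_compress_conv_inc ::
    "(real \<Rightarrow> real) \<Rightarrow> (real \<Rightarrow> nat) \<Rightarrow> real \<Rightarrow> (real \<Rightarrow> real \<Rightarrow> int) \<Rightarrow> real \<Rightarrow> real \<Rightarrow> real
      \<Rightarrow> (real \<times> real) set timed" where
  "scaled_compress_conv_inc \<phi> \<tau> \<kappa> pick \<epsilon> a b =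
     spend (\<tau> a + 1) (phi_min \<phi> {a..b}) \<triangleright> (\<lambda>m.
     spend 1 (scale_step \<kappa> \<epsilon> m) \<triangleright> (\<lambda>s.
     let \<rho> = (\<lambda>x. spend (\<tau> (s * x) + 1) (10 * \<phi> (s * x) / (\<epsilon> * m))) in
     \<rho> (a / s) \<triangleright> (\<lambda>ra.
     \<rho> (b / s) \<triangleright> (\<lambda>rb.
     compress_loop \<rho> pick \<epsilon> (b / s) rb (a / s) ra \<triangleright> (\<lambda>V.
     let W = {(a / s, \<lceil>ra\<rceil>), (b / s, \<lceil>rb\<rceil>)} \<union> V in
     spend (card W) ((\<lambda>(y, v). (s * y, \<epsilon> * m / 10 * of_int v)) ` W))))))"

text \<open>The routine for nonincreasing functions is the mirror image.\<close>

definition scaled_compress_conv_dec ::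
    "(real \<Rightarrow> real) \<Rightarrow> (real \<Rightarrow> nat) \<Rightarrow> real \<Rightarrow> (real \<Rightarrow> real \<Rightarrow> int) \<Rightarrow> real \<Rightarrow> real \<Rightarrow> real
      \<Rightarrow> (real \<times> real) set timed" where
  "scaled_compress_conv_dec \<phi> \<tau> \<kappa> pick \<epsilon> a b =
     scaled_compress_conv_inc (\<lambda>x. \<phi> (- x)) (\<lambda>x. \<tau> (- x)) \<kappa> pick \<epsilon> (- b) (- a) \<triangleright> (\<lambda>W.
     spend (card W) ((\<lambda>(x, v). (- x, v)) ` W))"

text \<open>\<open>xs\<close> is the minimizer and \<open>tx\<close> the time spent on computing it. The pair deleted from
  the union is the one recorded at \<open>xs\<close>, with its scaled value (\<open>\<phi> xs\<close> is the
  minimum on both halves of the domain). It is kept if \<open>xs\<close> is an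
  endpoint of the domain, since otherwise the extension would no longer be defined there.
  The \<open>n\<close> pairs are sorted in time \<open>n (1 + \<lceil>log\<^sub>2 n\<rceil>)\<close>.\<close>

definition scaled_compress_conv ::
    "(real \<Rightarrow> real) \<Rightarrow> (real \<Rightarrow> nat) \<Rightarrow> real \<Rightarrow> (real \<Rightarrow> real \<Rightarrow> int) \<Rightarrow> real \<Rightarrow> real \<Rightarrow> real
      \<Rightarrow> real \<Rightarrow> nat \<Rightarrow> (real \<times> real) list timed" where
  "scaled_compress_conv \<phi> \<tau> \<kappa> pick \<epsilon> A B xs tx =
     spend tx xs \<triangleright> (\<lambda>x.
     scaled_compress_conv_dec \<phi> \<tau> \<kappa> pick \<epsilon> A x \<triangleright> (\<lambda>W\<^sub>A.
     scaled_compress_conv_inc \<phi> \<tau> \<kappa> pick \<epsilon> x B \<triangleright> (\<lambda>W\<^sub>B.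
     spend (\<tau> x + 1) (\<epsilon> * \<phi> x / 10 * of_int \<lceil>10 * \<phi> x / (\<epsilon> * \<phi> x)\<rceil>) \<triangleright> (\<lambda>v.
     let n = card (W\<^sub>A \<union> W\<^sub>B);
         W = (W\<^sub>A \<union> W\<^sub>B) - (if A < x \<and> x < B then {(x, v)} else {}) in
     spend (n * (1 + ceillog2 n)) (sorted_key_list_of_set fst W)))))"


section \<open>Asymptotic bounds\<close>

text \<open>A logarithm in a big-O bound is read as at least 1: a bare one may be 0, negative or
  undefined here (constant \<open>\<phi>\<close>, \<open>\<epsilon> \<ge> 1\<close>, \<open>\<kappa> \<le> 1\<close>, \<open>A = 0\<close>, \<open>A = B\<close>).\<close>

definition Olog :: "real \<Rightarrow> real \<Rightarrow> real" where
  "Olog b x = max 1 (log b x)"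

text \<open>Values are stored as integer multiples of a fixed unit \<open>u\<close>; the space is that of a sign
  and the binary digits of the multiplier. With the unit \<open>scale_step \<kappa> \<epsilon> \<phi>min\<close> the multiplier
  of a domain value is of order \<open>\<kappa> max \<bar>A\<bar> \<bar>B\<bar> / (\<epsilon>\<^sup>2 \<phi>min)\<close>; bounding its length through
  \<open>log (\<phi>max / \<phi>min)\<close> costs an additional \<open>log (1 / \<phi>max)\<close> if \<open>\<phi>max < 1\<close>.\<close>

definition representable :: "real \<Rightarrow> real \<Rightarrow> real \<Rightarrow> bool" where
  "representable u n x \<longleftrightarrow>
     (\<exists>k::int. x = u * of_int k \<and> 1 + real_of_int \<lceil>log 2 (\<bar>of_int k\<bar> + 1)\<rceil> \<le> n)"

end

theory Submission
  imports Defs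
begin

text \<open>The scaling makes the slope of \<open>\<rho>\<close> at most \<open>\<epsilon> / 10\<close> while \<open>\<rho> \<ge> 10 / \<epsilon>\<close>. Hence a target window of
  height \<open>\<epsilon> \<rho>(x) / 10\<close> has width at least \<open>\<rho>(x) \<ge> 10 / \<epsilon>\<close>, which bounds the number of bisections by
  the logarithm of the width \<open>(b - a) / s\<close> over \<open>10 / \<epsilon>\<close>, and \<open>y'' - y' \<ge> 2 \<rho>(x) \<ge> 20 / \<epsilon>\<close>, which leaves
  room for an integer if \<open>\<epsilon> \<le> 20\<close>. Each step multiplies \<open>\<rho>\<close> by at least \<open>1 + 3\<epsilon>/10\<close>, and
  \<open>(1 + 3\<epsilon>/10)\<^sup>4 \<ge> 1 + \<epsilon>\<close>, so there are \<open>O(log\<^sub>K (\<phi>max / \<phi>min))\<close> steps. Between neighbouring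
  recorded points \<open>\<phi>\<close> grows by a factor of at most \<open>K\<close>, and the convex extension lies between \<open>\<phi>\<close> and
  the larger of the two neighbouring values. Dropping the minimizer is harmless: both of its
  neighbours have values at most \<open>K \<phi>min\<close>.\<close>

section \<open>Convex extensions\<close>

text \<open>The epigraph of \<open>\<phi>\<close> over \<open>D\<close> is convex and contains the
  generating points, hence their whole hull.\<close>

lemma convex_extension_ge:
  assumes "convex_on D \<phi>" "E \<subseteq> D" "(x, z) \<in> convex hull ((\<lambda>e. (e, \<phi> e)) ` E)"
  shows "\<phi> x \<le> z"
proof -
  have "convex hull ((\<lambda>e. (e, \<phi> e)) ` E) \<subseteq> epigraph D \<phi>"
    using assms(1,2) by (intro hull_minimal) (auto simp: mem_epigraph convex_epigraph)
  then show ?thesis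
    using assms(3) by (auto simp: mem_epigraph)
qed

text \<open>The epigraph gives the lower bound. For the upper bound, the chord from \<open>p\<close>
  to \<open>q\<close> meets the hull above \<open>x\<close>, and its height is a convex combination
  of the two values.\<close>

lemma convex_extension_bounds:
  assumes conv: "convex_on D \<phi>" and E: "E \<subseteq> D" and pq: "p \<in> E" "q \<in> E" "p \<le> x" "x \<le> q"
  shows "\<phi> x \<le> convex_extension \<phi> E x" "convex_extension \<phi> E x \<le> max (\<phi> p) (\<phi> q)"
proof -
  let ?H = "convex hull ((\<lambda>e. (e, \<phi> e)) ` E)"
  obtain u where u: "0 \<le> u" "u \<le> 1" "x = (1 - u) * p + u * q"
  proof -
    have "x \<in> closed_segment p q"
      using pq(3,4) by (simp add: closed_segment_eq_real_ivl)
    then show ?thesis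
      using that by (auto simp: in_segment)
  qed
  let ?z = "(1 - u) * \<phi> p + u * \<phi> q"
  have "(1 - u) *\<^sub>R (p, \<phi> p) + u *\<^sub>R (q, \<phi> q) \<in> ?H"
    using pq(1,2) u(1,2) by (intro convexD_alt convex_convex_hull hull_inc imageI)
  then have z: "(x, ?z) \<in> ?H"
    using u(3) by simp
  \<comment> \<open>The infimum of a set of reals carries information only if the set is nonempty
    and bounded below; \<open>z\<close> gives the former.\<close>
  have bdd: "bdd_below {z. (x, z) \<in> ?H}"
    by (rule bdd_belowI[of _ "\<phi> x"]) (simp add: convex_extension_ge[OF conv E])
  show "\<phi> x \<le> convex_extension \<phi> E x"
    unfolding convex_extension_def
    by (rule cInf_greatest) (use z convex_extension_ge[OF conv E] in blast)+
  have "convex_extension \<phi> E x \<le> ?z"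
    unfolding convex_extension_def by (rule cInf_lower) (use z bdd in simp_all)
  also have "?z \<le> max (\<phi> p) (\<phi> q)"
    using u by (intro convex_bound_le) auto
  finally show "convex_extension \<phi> E x \<le> max (\<phi> p) (\<phi> q)" .
qed

text \<open>The larger of the two values bounds the extension also where the minimizer between
  \<open>p\<close> and \<open>q\<close> has been deleted, so this condition suits the combined routine as well.\<close>

definition bracketing :: "real \<Rightarrow> (real \<Rightarrow> real) \<Rightarrow> real \<Rightarrow> real \<Rightarrow> real set \<Rightarrow> bool" where
  "bracketing K \<phi> A B E \<longleftrightarrow>
     (\<forall>x\<in>{A..B}. \<exists>p\<in>E. \<exists>q\<in>E. p \<le> x \<and> x \<le> q \<and> \<phi> p \<le> K * \<phi> x \<and> \<phi> q \<le> K * \<phi> x)"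

lemma K_approximation_set_if_bracketing:
  assumes "convex_on {A..B} \<phi>" "finite E" "E \<subseteq> {A..B}" "A \<in> E" "B \<in> E" "bracketing K \<phi> A B E"
  shows "K_approximation_set K \<phi> A B E"
proof -
  have min: "Min E = A"
    by (rule Min_eqI[OF assms(2) _ assms(4)]) (use assms(3) in auto)
  have max: "Max E = B"
    by (rule Max_eqI[OF assms(2) _ assms(5)]) (use assms(3) in auto)
  have ext: "\<phi> x \<le> convex_extension \<phi> E x \<and> convex_extension \<phi> E x \<le> K * \<phi> x"
    if x: "x \<in> {A..B}" for x
  proof -
    obtain p q where "p \<in> E" "q \<in> E" "p \<le> x" "x \<le> q" "\<phi> p \<le> K * \<phi> x" "\<phi> q \<le> K * \<phi> x"
      using assms(6) x unfolding bracketing_def by blast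
    then show ?thesis
      using convex_extension_bounds[OF assms(1,3), of p q x] by linarith
  qed
  show ?thesis
    unfolding K_approximation_set_def K_approximation_def
  proof (intro conjI ballI)
    show "E \<noteq> {}"
      using assms(4) by blast
  qed (use assms(2,3) min max ext in simp_all)
qed


section \<open>Binary search\<close>

lemma spend_andthen: "spend k x \<triangleright> q = Option.bind (q x) (\<lambda>r. Some (fst r, k + snd r))"
  by (simp add: spend_def andthen_def)

lemma Some_andthen: "Some (x, k) \<triangleright> q = Option.bind (q x) (\<lambda>r. Some (fst r, k + snd r))"
  by (simp add: andthen_def)

text \<open>The search keeps \<open>g lo < l\<close> and \<open>u < g hi\<close>, so the rise over
  the current interval always exceeds \<open>u - l\<close>. The slope bound \<open>L\<close> forbids
  this once the interval has been halved \<open>k\<close> times.\<close>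

lemma bisect_spec:
  assumes "\<And>z. z \<in> {lo..hi} \<Longrightarrow> \<exists>d\<le>t. f z = Some (g z, d)"
    and "\<And>v w. lo \<le> v \<Longrightarrow> v \<le> w \<Longrightarrow> w \<le> hi \<Longrightarrow> g w - g v \<le> L * (w - v)"
    and "g lo < l" "u < g hi" "lo \<le> hi" "L * (hi - lo) \<le> 2 ^ k * (u - l)"
  shows "\<exists>z T. bisect f l u lo hi = Some (z, T) \<and> z \<in> {lo..hi} \<and> l \<le> g z \<and> g z \<le> u
           \<and> T \<le> k * (t + 1) + 1"
  using assms
proof (induction k arbitrary: lo hi)
  case 0
  \<comment> \<open>The base case is contradictory: the rise is at most \<open>u - l\<close> by the
    slope bound, but larger than \<open>u - l\<close> by the outer inequalities.\<close>
  have "g hi - g lo \<le> L * (hi - lo)"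
    using 0(2)[of lo hi] 0(5) by blast
  then show ?case
    using 0(3,4,6) by simp
next
  case (Suc k)
  let ?mid = "(lo + hi) / 2"
  have mid: "lo \<le> ?mid" "?mid \<le> hi"
    using Suc.prems(5) by auto
  then obtain d where d: "d \<le> t" "f ?mid = Some (g ?mid, d)"
    using Suc.prems(1)[of ?mid] by auto
  \<comment> \<open>Halving the width pays for one factor 2 of the power.\<close>
  have half: "L * (hi - ?mid) \<le> 2 ^ k * (u - l)" "L * (?mid - lo) \<le> 2 ^ k * (u - l)"
    using Suc.prems(6) by (auto simp: field_simps)
  consider "g ?mid < l" | "l \<le> g ?mid" "u < g ?mid" | "l \<le> g ?mid" "g ?mid \<le> u"
    by linarith
  then show ?case
  proof cases
    case 1
    have "\<exists>z T. bisect f l u ?mid hi = Some (z, T) \<and> z \<in> {?mid..hi} \<and> l \<le> g z \<and> g z \<le> u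
           \<and> T \<le> k * (t + 1) + 1"
      using Suc.prems mid 1 half by (intro Suc.IH) auto
    then show ?thesis
      using 1 d mid by (subst bisect.simps) (auto simp: Some_andthen spend_def)
  next
    case 2
    have "\<exists>z T. bisect f l u lo ?mid = Some (z, T) \<and> z \<in> {lo..?mid} \<and> l \<le> g z \<and> g z \<le> u
           \<and> T \<le> k * (t + 1) + 1"
      using Suc.prems mid 2 half by (intro Suc.IH) auto
    then show ?thesis
      using 2 d mid by (subst bisect.simps) (auto simp: Some_andthen spend_def)
  next
    case 3
    then have "bisect f l u lo hi = Some (?mid, d + 2)"
      using d mid by (subst bisect.simps) (auto simp: Some_andthen spend_def)
    then show ?thesis
      using 3 d(1) mid by (intro exI[of _ ?mid] exI[of _ "d + 2"]) auto
  qed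
qed


section \<open>The compression loop\<close>

lemma picks_integer_wide:
  assumes "picks_integer pick" "y' + 1 \<le> y''"
  shows "y' \<le> of_int (pick y' y'') \<and> of_int (pick y' y'') \<le> y''"
proof -
  have "y' \<le> of_int \<lceil>y'\<rceil>" "of_int \<lceil>y'\<rceil> \<le> y''"
    using assms(2) by linarith+
  then show ?thesis
    using assms(1) unfolding picks_integer_def by blast
qed

text \<open>Induction on the budget \<open>n\<close> of recorded points: every step consumes one
  factor \<open>1 + 3/10 * \<epsilon>\<close> of the bound on \<open>g e\<close>. The width
  condition refers to the fixed left end \<open>a\<close>, so it survives each step because
  \<open>g x\<close> grows. Success and correctness are separate claims, as a run may get stuck for
  large \<open>\<epsilon>\<close>.\<close>

lemma compress_loop_spec:
  assumes "0 < \<epsilon>" and pick: "picks_integer pick"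
    and f: "\<And>z. z \<in> {a..e} \<Longrightarrow> \<exists>d\<le>t. f z = Some (g z, d)"
    and mono: "\<And>v w. a \<le> v \<Longrightarrow> v \<le> w \<Longrightarrow> w \<le> e \<Longrightarrow> g v \<le> g w"
    and lip: "\<And>v w. a \<le> v \<Longrightarrow> v \<le> w \<Longrightarrow> w \<le> e \<Longrightarrow> g w - g v \<le> \<epsilon> / 10 * (w - v)"
    and "x \<in> {a..e}" "10 / \<epsilon> \<le> g x" "e - a \<le> 2 ^ N * g x" "g e < (1 + 3/10 * \<epsilon>) ^ n * g x"
  shows "(\<epsilon> \<le> 20 \<longrightarrow> compress_loop f pick \<epsilon> e (g e) x (g x) \<noteq> None) \<and>
    (\<forall>V T. compress_loop f pick \<epsilon> e (g e) x (g x) = Some (V, T) \<longrightarrow>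
       (\<exists>Z. V = (\<lambda>y. (y, \<lceil>g y\<rceil>)) ` Z \<and> finite Z \<and> Z \<subseteq> {x<..e} \<and> Z \<subseteq> \<int> \<and> card Z \<le> n \<and>
          (\<forall>w\<in>{x..e}. \<exists>p\<in>insert x Z. \<exists>q\<in>insert e Z. p \<le> w \<and> w \<le> q \<and> g q \<le> (1 + \<epsilon>) * g p) \<and>
          T \<le> n * (2 * (N * (t + 1)) + t + 5) + 2))"
  using assms(6-9)
proof (induction n arbitrary: x)
  case 0
  \<comment> \<open>An empty budget means \<open>g e < g x\<close>, which contradicts
    monotonicity.\<close>
  then show ?case
    using mono[of x e] by auto
next
  case (Suc n)
  let ?run = "compress_loop f pick \<epsilon> e (g e)"
  have gx: "0 < g x"
    using Suc.prems(2) \<open>0 < \<epsilon>\<close> by (smt (verit) divide_pos_pos)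
  have \<epsilon>gx: "0 < \<epsilon> * g x"
    using gx \<open>0 < \<epsilon>\<close> by simp
  show ?case
  proof (cases "(1 + \<epsilon>) * g x < g e")
    case False
    \<comment> \<open>The loop stops here, and \<open>x\<close> and \<open>e\<close> themselves
      bracket the remaining interval. The 2 steps are the additive constant of the time
      bound.\<close>
    then have "?run x (g x) = Some ({}, 2)"
      by (subst compress_loop.simps) (auto simp: Some_andthen spend_def)
    then show ?thesis
      using False Suc.prems(1) by (auto intro!: exI[of _ "{}"])
  next
    case True
    \<comment> \<open>Both searches are treated at once. The window has height
      \<open>\<epsilon> / 10 * g x\<close>, so with slope \<open>\<epsilon> / 10\<close> the
      condition of the search becomes \<open>e - x \<le> 2 ^ N * g x\<close>. The bound
      \<open>\<alpha> \<le> 9\<close> keeps the window below \<open>(1 + \<epsilon>) * g x\<close>,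
      hence below \<open>g e\<close>.\<close>
    have bis: "\<exists>z T. bisect f ((1 + \<alpha>/10 * \<epsilon>) * g x) ((1 + \<beta>/10 * \<epsilon>) * g x) x e = Some (z, T) \<and>
        z \<in> {x..e} \<and> (1 + \<alpha>/10 * \<epsilon>) * g x \<le> g z \<and> g z \<le> (1 + \<beta>/10 * \<epsilon>) * g x \<and>
        T \<le> N * (t + 1) + 1" if "0 < \<alpha>" "\<alpha> \<le> 9" "\<beta> = \<alpha> + 1" for \<alpha> \<beta>
    proof (rule bisect_spec[where L = "\<epsilon> / 10"])
      have "\<alpha> * (\<epsilon> * g x) > 0"
        using \<epsilon>gx that by simp
      moreover have "\<beta> / 10 * (\<epsilon> * g x) \<le> 1 * (\<epsilon> * g x)"
        using \<epsilon>gx that by (intro mult_right_mono) auto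
      moreover have "(1 + \<alpha>/10 * \<epsilon>) * g x = g x + \<alpha> * (\<epsilon> * g x) / 10"
          "(1 + \<beta>/10 * \<epsilon>) * g x = g x + \<beta> / 10 * (\<epsilon> * g x)"
          "(1 + \<epsilon>) * g x = g x + \<epsilon> * g x"
        by (simp_all add: algebra_simps)
      ultimately show "g x < (1 + \<alpha>/10 * \<epsilon>) * g x" "(1 + \<beta>/10 * \<epsilon>) * g x < g e"
        using True by linarith+
      have "e - x \<le> 2 ^ N * g x"
        using Suc.prems(1,3) by auto
      then have "\<epsilon> / 10 * (e - x) \<le> \<epsilon> / 10 * (2 ^ N * g x)"
        using \<open>0 < \<epsilon>\<close> by (intro mult_left_mono) auto
      then show "\<epsilon> / 10 * (e - x)
          \<le> 2 ^ N * ((1 + \<beta>/10 * \<epsilon>) * g x - (1 + \<alpha>/10 * \<epsilon>) * g x)"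
        using that(3) by (simp add: algebra_simps add_divide_distrib)
      show "\<exists>d\<le>t. f z = Some (g z, d)" if "z \<in> {x..e}" for z
        using Suc.prems(1) that by (intro f) auto
      show "g w - g v \<le> \<epsilon> / 10 * (w - v)" if "x \<le> v" "v \<le> w" "w \<le> e" for v w
        using Suc.prems(1) that by (intro lip) auto
      show "x \<le> e"
        using Suc.prems(1) by simp
    qed
    have coeffs: "(0::real) < 3" "(3::real) \<le> 9" "(4::real) = 3 + 1"
        "(0::real) < 6" "(6::real) \<le> 9" "(7::real) = 6 + 1"
      by simp_all
    obtain y' T' where y': "bisect f ((1 + 3/10 * \<epsilon>) * g x) ((1 + 4/10 * \<epsilon>) * g x) x e = Some (y', T')"
        "y' \<in> {x..e}" "(1 + 3/10 * \<epsilon>) * g x \<le> g y'" "g y' \<le> (1 + 4/10 * \<epsilon>) * g x"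
        "T' \<le> N * (t + 1) + 1"
      using bis[OF coeffs(1-3)] by blast
    obtain y'' T'' where y'': "bisect f ((1 + 6/10 * \<epsilon>) * g x) ((1 + 7/10 * \<epsilon>) * g x) x e = Some (y'', T'')"
        "y'' \<in> {x..e}" "(1 + 6/10 * \<epsilon>) * g x \<le> g y''" "g y'' \<le> (1 + 7/10 * \<epsilon>) * g x"
        "T'' \<le> N * (t + 1) + 1"
      using bis[OF coeffs(4-6)] by blast
    define y where "y = real_of_int (pick y' y'')"
    note step = True y'(1) y''(1)
    show ?thesis
    proof (cases "y' \<le> y \<and> y \<le> y''")
      case False
      \<comment> \<open>A stuck run forces large \<open>\<epsilon>\<close>: the values at
        \<open>y'\<close> and \<open>y''\<close> differ by at least
        \<open>2/10 * \<epsilon> * g x\<close>, so slope \<open>\<epsilon> / 10\<close> separates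
        the points by at least \<open>2 * g x\<close>, which is at least 1 if
        \<open>\<epsilon> \<le> 20\<close>.\<close>
      have "\<epsilon> > 20"
      proof (rule ccontr)
        assume "\<not> \<epsilon> > 20"
        then have "1 / 2 \<le> 10 / \<epsilon>"
          using \<open>0 < \<epsilon>\<close> by (simp add: field_simps)
        then have "1 \<le> 2 * g x"
          using Suc.prems(2) by linarith
        have "(1 + 4/10 * \<epsilon>) * g x < (1 + 6/10 * \<epsilon>) * g x"
          using gx \<open>0 < \<epsilon>\<close> by (intro mult_strict_right_mono) auto
        then have "g y' < g y''"
          using y'(4) y''(3) by linarith
        then have "y' \<le> y''"
          using y'(2) y''(2) mono[of y'' y'] Suc.prems(1) by (cases "y' \<le> y''") auto
        then have "g y'' - g y' \<le> \<epsilon> / 10 * (y'' - y')"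
          using y'(2) y''(2) Suc.prems(1) by (intro lip) auto
        then have "\<epsilon> / 10 * (2 * g x) \<le> \<epsilon> / 10 * (y'' - y')"
          using y'(4) y''(3) by (simp add: algebra_simps)
        then have "2 * g x \<le> y'' - y'"
          using \<open>0 < \<epsilon>\<close> by simp
        then show False
          using \<open>1 \<le> 2 * g x\<close> picks_integer_wide[OF pick, of y' y''] False by (simp add: y_def)
      qed
      moreover have "?run x (g x) = None"
        using False
        by (subst compress_loop.simps,
            simp only: step Some_andthen spend_def if_True Option.bind.simps fst_conv snd_conv,
            auto simp flip: y_def)
      ultimately show ?thesis
        by simp
    next
      case True
      then have y: "y \<in> {x..e}" "y \<in> \<int>"
        using y'(2) y''(2) by (auto simp: y_def)
      \<comment> \<open>By monotonicity the chosen integer inherits the lower factor of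
        \<open>y'\<close>, which guarantees progress, and the upper factor of \<open>y''\<close>,
        which keeps the gap below \<open>1 + \<epsilon>\<close>.\<close>
      have "g y' \<le> g y" "g y \<le> g y''"
        using True y'(2) y''(2) Suc.prems(1) by (auto intro!: mono)
      then have gy: "(1 + 3/10 * \<epsilon>) * g x \<le> g y" "g y \<le> (1 + 7/10 * \<epsilon>) * g x"
        using y'(3) y''(4) by linarith+
      have "1 * g x < (1 + 3/10 * \<epsilon>) * g x"
        using gx \<open>0 < \<epsilon>\<close> by (intro mult_strict_right_mono) auto
      then have "g x < g y"
        using gy(1) by linarith
      then have "x < y"
        using y(1) by (cases "x = y") auto
      obtain d where d: "d \<le> t" "f y = Some (g y, d)"
        using f[of y] y(1) Suc.prems(1) by auto
      \<comment> \<open>The 3 counts entering the loop, picking the integer and inserting the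
        pair.\<close>
      have run: "?run x (g x) = Option.bind (?run y (g y))
          (\<lambda>r. Some (insert (y, \<lceil>g y\<rceil>) (fst r), d + (snd r + (T' + T'' + 3))))"
        using True d(2)
        by (subst compress_loop.simps,
            simp only: step Some_andthen spend_def if_True Option.bind.simps fst_conv snd_conv,
            cases "?run y (g y)")
          (simp_all add: Some_andthen andthen_def flip: y_def)
      have "e - a \<le> 2 ^ N * g y"
        using order_trans[OF Suc.prems(3), of "2 ^ N * g y"] \<open>g x < g y\<close> by simp
      moreover have "g e < (1 + 3/10 * \<epsilon>) ^ n * g y"
      proof -
        have "(1 + 3/10 * \<epsilon>) ^ n * ((1 + 3/10 * \<epsilon>) * g x) \<le> (1 + 3/10 * \<epsilon>) ^ n * g y"
          using gy(1) \<open>0 < \<epsilon>\<close> by (intro mult_left_mono) auto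
        then show ?thesis
          using Suc.prems(4) by (simp add: mult_ac)
      qed
      ultimately have IH: "(\<epsilon> \<le> 20 \<longrightarrow> ?run y (g y) \<noteq> None) \<and>
        (\<forall>V T. ?run y (g y) = Some (V, T) \<longrightarrow>
           (\<exists>Z. V = (\<lambda>y. (y, \<lceil>g y\<rceil>)) ` Z \<and> finite Z \<and> Z \<subseteq> {y<..e} \<and> Z \<subseteq> \<int> \<and> card Z \<le> n \<and>
              (\<forall>w\<in>{y..e}. \<exists>p\<in>insert y Z. \<exists>q\<in>insert e Z. p \<le> w \<and> w \<le> q \<and> g q \<le> (1 + \<epsilon>) * g p) \<and>
              T \<le> n * (2 * (N * (t + 1)) + t + 5) + 2))"
        using y(1) Suc.prems(1,2) \<open>g x < g y\<close> by (intro Suc.IH) auto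
      show ?thesis
      proof (intro conjI allI impI)
        assume "\<epsilon> \<le> 20"
        then show "?run x (g x) \<noteq> None"
          using IH run by (auto split: Option.bind_splits)
      next
        fix V T
        assume "?run x (g x) = Some (V, T)"
        then obtain V' T0 where V': "?run y (g y) = Some (V', T0)" "V = insert (y, \<lceil>g y\<rceil>) V'"
            "T = d + (T0 + (T' + T'' + 3))"
          using run by (auto split: Option.bind_splits)
        then obtain Z where Z: "V' = (\<lambda>y. (y, \<lceil>g y\<rceil>)) ` Z" "finite Z" "Z \<subseteq> {y<..e}" "Z \<subseteq> \<int>"
            "card Z \<le> n" "T0 \<le> n * (2 * (N * (t + 1)) + t + 5) + 2"
          and br: "\<forall>w\<in>{y..e}. \<exists>p\<in>insert y Z. \<exists>q\<in>insert e Z.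
                     p \<le> w \<and> w \<le> q \<and> g q \<le> (1 + \<epsilon>) * g p"
          using IH by blast
        have "\<exists>p\<in>insert x (insert y Z). \<exists>q\<in>insert e (insert y Z).
            p \<le> w \<and> w \<le> q \<and> g q \<le> (1 + \<epsilon>) * g p" if "w \<in> {x..e}" for w
        proof (cases "w \<le> y")
          case True
          have "(1 + 7/10 * \<epsilon>) * g x \<le> (1 + \<epsilon>) * g x"
            using gx \<open>0 < \<epsilon>\<close> by (intro mult_right_mono) auto
          then have "g y \<le> (1 + \<epsilon>) * g x"
            using gy(2) by linarith
          then show ?thesis
            using True that by auto
        next
          case False
          then have "w \<in> {y..e}"
            using that by simp
          then show ?thesis
            using br by blast
        qed
        \<comment> \<open>The 5 is made of these 3 steps and the final step of each of the two
          searches; \<open>t\<close> pays for evaluating at \<open>y\<close>.\<close>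
        moreover have "T \<le> Suc n * (2 * (N * (t + 1)) + t + 5) + 2"
          using V'(3) Z(6) y'(5) y''(5) d(1) by simp
        ultimately show "\<exists>Z. V = (\<lambda>y. (y, \<lceil>g y\<rceil>)) ` Z \<and> finite Z \<and> Z \<subseteq> {x<..e} \<and> Z \<subseteq> \<int> \<and>
            card Z \<le> Suc n \<and>
            (\<forall>w\<in>{x..e}. \<exists>p\<in>insert x Z. \<exists>q\<in>insert e Z. p \<le> w \<and> w \<le> q \<and> g q \<le> (1 + \<epsilon>) * g p) \<and>
            T \<le> Suc n * (2 * (N * (t + 1)) + t + 5) + 2"
          using V'(2) Z(1-5) y \<open>x < y\<close>
          by (intro exI[of _ "insert y Z"] conjI) (auto simp: card_insert_if)
      qed
    qed
  qed
qed


section \<open>The monotone routines\<close>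

lemma phi_min_eq:
  assumes "a \<in> D" "0 < \<phi> a" "\<And>x. x \<in> D \<Longrightarrow> \<phi> a \<le> \<phi> x"
  shows "phi_min \<phi> D = \<phi> a"
  unfolding phi_min_def
proof (rule cInf_eq_minimum)
  show "\<phi> a \<in> {\<bar>\<phi> x\<bar> | x. x \<in> D \<and> \<phi> x \<noteq> 0}"
    using assms(1,2) by (auto intro!: exI[of _ a])
next
  fix y assume "y \<in> {\<bar>\<phi> x\<bar> | x. x \<in> D \<and> \<phi> x \<noteq> 0}"
  then show "\<phi> a \<le> y"
    using assms(3) by force
qed

text \<open>The rescaled pair that the algorithm outputs for the point \<open>z\<close>. It depends
  on \<open>z\<close> alone once \<open>\<epsilon>\<close> and \<open>m\<close> are fixed, so
  outputs are images of point sets, and unions and deletions can be computed on points.\<close>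

definition rounded :: "(real \<Rightarrow> real) \<Rightarrow> real \<Rightarrow> real \<Rightarrow> real \<Rightarrow> real \<times> real" where
  "rounded \<phi> \<epsilon> m z = (z, \<epsilon> * m / 10 * of_int \<lceil>10 * \<phi> z / (\<epsilon> * m)\<rceil>)"

text \<open>The scaled function \<open>g\<close> meets the conditions of the loop; the premise on
  \<open>N\<close> is the width condition \<open>(b - a) / s \<le> 2 ^ N * (10 / \<epsilon>)\<close>
  written without the scaling.\<close>

lemma scaled_compress_conv_inc_spec:
  assumes ab: "a \<le> b"
    and mono: "\<And>v w. a \<le> v \<Longrightarrow> v \<le> w \<Longrightarrow> w \<le> b \<Longrightarrow> \<phi> v \<le> \<phi> w"
    and lip: "lipschitz_on \<kappa> {a..b} \<phi>" and "0 < \<kappa>" and "0 < \<epsilon>" and "0 < \<phi> a"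
    and \<tau>: "\<And>z. z \<in> {a..b} \<Longrightarrow> \<tau> z \<le> t" and pick: "picks_integer pick"
    and N: "10 * \<kappa> * (b - a) \<le> 2 ^ N * (\<epsilon> * \<phi> a)"
    and n: "\<phi> b < (1 + 3/10 * \<epsilon>) ^ n * \<phi> a"
  shows "(\<epsilon> \<le> 20 \<longrightarrow> scaled_compress_conv_inc \<phi> \<tau> \<kappa> pick \<epsilon> a b \<noteq> None) \<and>
    (\<forall>W T. scaled_compress_conv_inc \<phi> \<tau> \<kappa> pick \<epsilon> a b = Some (W, T) \<longrightarrow>
      (\<exists>Z. W = rounded \<phi> \<epsilon> (\<phi> a) ` ({a, b} \<union> Z) \<and> finite Z \<and> Z \<subseteq> {a<..b} \<and>
         (\<forall>z\<in>Z. \<exists>k::int. z = scale_step \<kappa> \<epsilon> (\<phi> a) * of_int k) \<and> card Z \<le> n \<and>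
         (\<forall>x\<in>{a..b}. \<exists>p\<in>insert a Z. \<exists>q\<in>insert b Z. p \<le> x \<and> x \<le> q \<and> \<phi> q \<le> (1 + \<epsilon>) * \<phi> p) \<and>
         T \<le> n * (2 * (N * (t + 2)) + t + 6) + 3 * t + n + 8))"
proof -
  define m where "m = \<phi> a"
  define s where "s = scale_step \<kappa> \<epsilon> m"
  define g where "g = (\<lambda>z. 10 * \<phi> (s * z) / (\<epsilon> * m))"
  let ?f = "\<lambda>z. spend (\<tau> (s * z) + 1) (g z)"
  let ?loop = "compress_loop ?f pick \<epsilon> (b / s) (g (b / s)) (a / s) (g (a / s))"
  have m: "0 < m" "phi_min \<phi> {a..b} = m"
    unfolding m_def using \<open>0 < \<phi> a\<close> ab mono by (auto intro!: phi_min_eq)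
  have s: "0 < s"
    using m(1) \<open>0 < \<kappa>\<close> \<open>0 < \<epsilon>\<close> by (simp add: s_def scale_step_def)
  have dom: "s * z \<in> {a..b}" if "z \<in> {a / s..b / s}" for z
    using that s by (auto simp: field_simps)
  have \<epsilon>m: "0 < \<epsilon> * m"
    using m(1) \<open>0 < \<epsilon>\<close> by simp
  have g_mono: "g v \<le> g w" if "a / s \<le> v" "v \<le> w" "w \<le> b / s" for v w
    unfolding g_def using \<epsilon>m dom[of v] dom[of w] that s
    by (intro divide_right_mono mult_left_mono mono) auto
  \<comment> \<open>The step \<open>s\<close> is chosen for this: the slope
    \<open>10 / (\<epsilon> * m) * \<kappa> * s\<close> equals
    \<open>\<epsilon> / 10\<close>.\<close>
  have g_lip: "g w - g v \<le> \<epsilon> / 10 * (w - v)" if "a / s \<le> v" "v \<le> w" "w \<le> b / s" for v w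
  proof -
    have "dist (\<phi> (s * w)) (\<phi> (s * v)) \<le> \<kappa> * dist (s * w) (s * v)"
      using dom[of v] dom[of w] that by (intro lipschitz_onD[OF lip]) auto
    also have "dist (s * w) (s * v) = s * (w - v)"
      using s that by (simp add: dist_real_def flip: right_diff_distrib)
    finally have "\<phi> (s * w) - \<phi> (s * v) \<le> \<kappa> * s * (w - v)"
      by (simp add: dist_real_def mult_ac)
    then have "10 / (\<epsilon> * m) * (\<phi> (s * w) - \<phi> (s * v)) \<le> 10 / (\<epsilon> * m) * (\<kappa> * s * (w - v))"
      using \<epsilon>m by (intro mult_left_mono) auto
    also have "10 / (\<epsilon> * m) * (\<kappa> * s * (w - v)) = \<epsilon> / 10 * (w - v)"
      using m(1) \<open>0 < \<kappa>\<close> \<open>0 < \<epsilon>\<close>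
      by (simp add: s_def scale_step_def field_simps power2_eq_square)
    finally show ?thesis
      by (simp add: g_def right_diff_distrib diff_divide_distrib)
  qed
  have ga: "g (a / s) = 10 / \<epsilon>"
    using m(1) s by (simp add: g_def m_def)
  have width: "b / s - a / s \<le> 2 ^ N * g (a / s)"
  proof -
    have "10 * \<kappa> * (b - a) * 10 / (\<epsilon> * (\<epsilon> * m)) \<le> 2 ^ N * (\<epsilon> * m) * 10 / (\<epsilon> * (\<epsilon> * m))"
      using N \<epsilon>m \<open>0 < \<epsilon>\<close> by (intro divide_right_mono mult_right_mono) (auto simp: m_def)
    also have "2 ^ N * (\<epsilon> * m) * 10 / (\<epsilon> * (\<epsilon> * m)) = 2 ^ N * (10 / \<epsilon>)"
      using m(1) by simp
    finally show ?thesis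
      unfolding ga using m(1) \<open>0 < \<kappa>\<close> \<open>0 < \<epsilon>\<close>
      by (simp add: s_def scale_step_def power2_eq_square right_diff_distrib mult_ac
          flip: diff_divide_distrib)
  qed
  have steps: "g (b / s) < (1 + 3/10 * \<epsilon>) ^ n * g (a / s)"
  proof -
    have "g (b / s) = 10 / (\<epsilon> * m) * \<phi> b"
      using s by (simp add: g_def)
    also have "\<dots> < 10 / (\<epsilon> * m) * ((1 + 3/10 * \<epsilon>) ^ n * m)"
      using n \<epsilon>m by (intro mult_strict_left_mono) (auto simp: m_def)
    also have "\<dots> = (1 + 3/10 * \<epsilon>) ^ n * g (a / s)"
      unfolding ga using m(1) by simp
    finally show ?thesis .
  qed
  have loop: "(\<epsilon> \<le> 20 \<longrightarrow> ?loop \<noteq> None) \<and>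
    (\<forall>V T. ?loop = Some (V, T) \<longrightarrow>
       (\<exists>Z. V = (\<lambda>y. (y, \<lceil>g y\<rceil>)) ` Z \<and> finite Z \<and> Z \<subseteq> {a/s<..b/s} \<and> Z \<subseteq> \<int> \<and> card Z \<le> n \<and>
          (\<forall>w\<in>{a/s..b/s}. \<exists>p\<in>insert (a/s) Z. \<exists>q\<in>insert (b/s) Z.
              p \<le> w \<and> w \<le> q \<and> g q \<le> (1 + \<epsilon>) * g p) \<and>
          T \<le> n * (2 * (N * (t + 1 + 1)) + (t + 1) + 5) + 2))"
  proof (rule compress_loop_spec[where a = "a/s"])
    show "\<exists>d\<le>t + 1. ?f z = Some (g z, d)" if "z \<in> {a/s..b/s}" for z
      using \<tau>[OF dom[OF that]] by (simp add: spend_def)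
    show "a / s \<in> {a / s..b / s}"
      using ab s by (simp add: divide_right_mono)
  qed (use pick \<open>0 < \<epsilon>\<close> g_mono g_lip width steps ga in simp_all)
  \<comment> \<open>\<open>\<phi>\<close> is evaluated twice at \<open>a\<close>, once for the
    minimum and once for the scaled function.\<close>
  have run: "scaled_compress_conv_inc \<phi> \<tau> \<kappa> pick \<epsilon> a b = Option.bind ?loop (\<lambda>r.
     let W = {(a / s, \<lceil>g (a / s)\<rceil>), (b / s, \<lceil>g (b / s)\<rceil>)} \<union> fst r in
     Some ((\<lambda>(y, v). (s * y, \<epsilon> * m / 10 * of_int v)) ` W,
       \<tau> a + \<tau> a + \<tau> b + 4 + snd r + card W))"
  proof -
    have ends: "s * (a / s) = a" "s * (b / s) = b"
      using s by simp_all
    show ?thesis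
      unfolding scaled_compress_conv_inc_def m(2) spend_andthen Let_def
      unfolding s_def[symmetric] g_def andthen_def ends
      by (cases "compress_loop (\<lambda>z. spend (\<tau> (s * z) + 1) (10 * \<phi> (s * z) / (\<epsilon> * m)))
        pick \<epsilon> (b / s) (10 * \<phi> b / (\<epsilon> * m)) (a / s) (10 * \<phi> a / (\<epsilon> * m))")
        (simp_all add: spend_def)
  qed
  show ?thesis
  proof (intro conjI allI impI)
    assume "\<epsilon> \<le> 20"
    then show "scaled_compress_conv_inc \<phi> \<tau> \<kappa> pick \<epsilon> a b \<noteq> None"
      using loop unfolding run by (auto simp: Let_def)
  next
    fix W T
    assume "scaled_compress_conv_inc \<phi> \<tau> \<kappa> pick \<epsilon> a b = Some (W, T)"
    then obtain V T0 where V: "?loop = Some (V, T0)"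
      and W0: "W = (\<lambda>(y, v). (s * y, \<epsilon> * m / 10 * of_int v)) `
                ({(a / s, \<lceil>g (a / s)\<rceil>), (b / s, \<lceil>g (b / s)\<rceil>)} \<union> V)"
      and T: "T = \<tau> a + \<tau> a + \<tau> b + 4 + T0 +
                card ({(a / s, \<lceil>g (a / s)\<rceil>), (b / s, \<lceil>g (b / s)\<rceil>)} \<union> V)"
      unfolding run by (cases ?loop) (auto simp: Let_def)
    obtain Z where Z: "V = (\<lambda>y. (y, \<lceil>g y\<rceil>)) ` Z" "finite Z" "Z \<subseteq> {a/s<..b/s}" "Z \<subseteq> \<int>"
        "card Z \<le> n" "T0 \<le> n * (2 * (N * (t + 1 + 1)) + (t + 1) + 5) + 2"
      and br: "\<forall>w\<in>{a/s..b/s}. \<exists>p\<in>insert (a/s) Z. \<exists>q\<in>insert (b/s) Z.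
              p \<le> w \<and> w \<le> q \<and> g q \<le> (1 + \<epsilon>) * g p"
      using loop V by blast
    have "W = rounded \<phi> \<epsilon> (\<phi> a) ` ((*) s ` ({a / s, b / s} \<union> Z))"
      unfolding W0 Z(1) rounded_def g_def m_def[symmetric] by (simp add: image_image)
    also have "(*) s ` ({a / s, b / s} \<union> Z) = {a, b} \<union> (*) s ` Z"
      using s by auto
    finally have W: "W = rounded \<phi> \<epsilon> (\<phi> a) ` ({a, b} \<union> (*) s ` Z)" .
    \<comment> \<open>Integers on the scaled axis become multiples of \<open>s\<close>. The
      endpoints are kept out of \<open>Z\<close> in this claim, since \<open>a / s\<close> and
      \<open>b / s\<close> need not be integers.\<close>
    have lattice: "\<exists>k::int. z = scale_step \<kappa> \<epsilon> (\<phi> a) * of_int k" if "z \<in> (*) s ` Z" for z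
      using that Z(4) by (auto simp: s_def m_def Ints_def)
    have br': "\<exists>p\<in>insert a ((*) s ` Z). \<exists>q\<in>insert b ((*) s ` Z).
        p \<le> x \<and> x \<le> q \<and> \<phi> q \<le> (1 + \<epsilon>) * \<phi> p" if x: "x \<in> {a..b}" for x
    proof -
      have "x / s \<in> {a / s..b / s}"
        using x s by (simp add: divide_right_mono)
      then obtain p q where pq: "p \<in> insert (a/s) Z" "q \<in> insert (b/s) Z" "p \<le> x / s" "x / s \<le> q"
          "g q \<le> (1 + \<epsilon>) * g p"
        using br by blast
      have "\<phi> (s * q) \<le> (1 + \<epsilon>) * \<phi> (s * p)"
      proof (rule mult_left_le_imp_le)
        show "10 / (\<epsilon> * m) * \<phi> (s * q) \<le> 10 / (\<epsilon> * m) * ((1 + \<epsilon>) * \<phi> (s * p))"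
          using pq(5) unfolding g_def by (simp only: times_divide_eq_left times_divide_eq_right mult_ac)
      qed (use \<epsilon>m in simp)
      moreover have "s * p \<in> insert a ((*) s ` Z)" "s * q \<in> insert b ((*) s ` Z)"
        using pq(1,2) s by auto
      moreover have "s * p \<le> x" "x \<le> s * q"
        using pq(3,4) s by (simp_all add: field_simps)
      ultimately show ?thesis
        by blast
    qed
    have "card ({(a / s, \<lceil>g (a / s)\<rceil>), (b / s, \<lceil>g (b / s)\<rceil>)} \<union> V) \<le> 2 + n"
    proof -
      have "card V \<le> n"
        using Z(1,2,5) card_image_le le_trans by blast
      moreover have "card {(a / s, \<lceil>g (a / s)\<rceil>), (b / s, \<lceil>g (b / s)\<rceil>)} \<le> 2"
        by (simp add: card_insert_if)
      ultimately show ?thesis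
        by (intro order_trans[OF card_Un_le] add_mono)
    qed
    moreover have "\<tau> a \<le> t" "\<tau> b \<le> t"
      using \<tau> ab by auto
    moreover have "n * (2 * (N * (t + 1 + 1)) + (t + 1) + 5) = n * (2 * (N * (t + 2)) + t + 6)"
      by simp
    \<comment> \<open>The 8 is 4 for the preparation, 2 for leaving the loop and 2 for rescaling the
      endpoint pairs.\<close>
    ultimately have "T \<le> n * (2 * (N * (t + 2)) + t + 6) + 3 * t + n + 8"
      using Z(6) T by linarith
    moreover have "(*) s ` Z \<subseteq> {a<..b}"
      using Z(3) s by (auto simp: field_simps)
    moreover have "card ((*) s ` Z) \<le> n"
      using Z(2,5) card_image_le le_trans by blast
    ultimately show "\<exists>Z. W = rounded \<phi> \<epsilon> (\<phi> a) ` ({a, b} \<union> Z) \<and> finite Z \<and> Z \<subseteq> {a<..b} \<and>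
         (\<forall>z\<in>Z. \<exists>k::int. z = scale_step \<kappa> \<epsilon> (\<phi> a) * of_int k) \<and> card Z \<le> n \<and>
         (\<forall>x\<in>{a..b}. \<exists>p\<in>insert a Z. \<exists>q\<in>insert b Z. p \<le> x \<and> x \<le> q \<and> \<phi> q \<le> (1 + \<epsilon>) * \<phi> p) \<and>
         T \<le> n * (2 * (N * (t + 2)) + t + 6) + 3 * t + n + 8"
      using W Z(2) lattice br' by (intro exI[of _ "(*) s ` Z"] conjI ballI) auto
  qed
qed

text \<open>Reflection at 0 reduces this to the nondecreasing case. Mirroring the at most
  \<open>n + 2\<close> pairs back accounts for the larger additive terms in the time bound.\<close>

lemma scaled_compress_conv_dec_spec:
  assumes ab: "a \<le> b"
    and mono: "\<And>v w. a \<le> v \<Longrightarrow> v \<le> w \<Longrightarrow> w \<le> b \<Longrightarrow> \<phi> w \<le> \<phi> v"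
    and lip: "lipschitz_on \<kappa> {a..b} \<phi>" and "0 < \<kappa>" and "0 < \<epsilon>" and "0 < \<phi> b"
    and \<tau>: "\<And>z. z \<in> {a..b} \<Longrightarrow> \<tau> z \<le> t" and pick: "picks_integer pick"
    and N: "10 * \<kappa> * (b - a) \<le> 2 ^ N * (\<epsilon> * \<phi> b)"
    and n: "\<phi> a < (1 + 3/10 * \<epsilon>) ^ n * \<phi> b"
  shows "(\<epsilon> \<le> 20 \<longrightarrow> scaled_compress_conv_dec \<phi> \<tau> \<kappa> pick \<epsilon> a b \<noteq> None) \<and>
    (\<forall>W T. scaled_compress_conv_dec \<phi> \<tau> \<kappa> pick \<epsilon> a b = Some (W, T) \<longrightarrow>
      (\<exists>Z. W = rounded \<phi> \<epsilon> (\<phi> b) ` ({a, b} \<union> Z) \<and> finite Z \<and> Z \<subseteq> {a..<b} \<and>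
         (\<forall>z\<in>Z. \<exists>k::int. z = scale_step \<kappa> \<epsilon> (\<phi> b) * of_int k) \<and> card Z \<le> n \<and>
         (\<forall>x\<in>{a..b}. \<exists>p\<in>insert a Z. \<exists>q\<in>insert b Z. p \<le> x \<and> x \<le> q \<and> \<phi> p \<le> (1 + \<epsilon>) * \<phi> q) \<and>
         T \<le> n * (2 * (N * (t + 2)) + t + 6) + 3 * t + 2 * n + 10))"
proof -
  let ?inc = "scaled_compress_conv_inc (\<lambda>x. \<phi> (- x)) (\<lambda>x. \<tau> (- x)) \<kappa> pick \<epsilon> (- b) (- a)"
  have lip': "lipschitz_on \<kappa> {- b..- a} (\<lambda>x. \<phi> (- x))"
  proof (rule lipschitz_onI)
    show "dist (\<phi> (- x)) (\<phi> (- y)) \<le> \<kappa> * dist x y" if "x \<in> {- b..- a}" "y \<in> {- b..- a}" for x y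
      using lipschitz_onD[OF lip, of "- x" "- y"] that by (auto simp: dist_minus)
  qed (use \<open>0 < \<kappa>\<close> in simp)
  \<comment> \<open>The double negation in \<open>\<phi> (- (- b))\<close> makes this a literal
    instance of the nondecreasing case with left end \<open>- b\<close>.\<close>
  have inc: "(\<epsilon> \<le> 20 \<longrightarrow> ?inc \<noteq> None) \<and>
    (\<forall>W T. ?inc = Some (W, T) \<longrightarrow>
      (\<exists>Z. W = rounded (\<lambda>x. \<phi> (- x)) \<epsilon> (\<phi> (- (- b))) ` ({- b, - a} \<union> Z) \<and> finite Z \<and>
         Z \<subseteq> {- b<..- a} \<and>
         (\<forall>z\<in>Z. \<exists>k::int. z = scale_step \<kappa> \<epsilon> (\<phi> (- (- b))) * of_int k) \<and> card Z \<le> n \<and>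
         (\<forall>x\<in>{- b..- a}. \<exists>p\<in>insert (- b) Z. \<exists>q\<in>insert (- a) Z.
             p \<le> x \<and> x \<le> q \<and> \<phi> (- q) \<le> (1 + \<epsilon>) * \<phi> (- p)) \<and>
         T \<le> n * (2 * (N * (t + 2)) + t + 6) + 3 * t + n + 8))"
    by (rule scaled_compress_conv_inc_spec)
      (use ab lip' \<open>0 < \<kappa>\<close> \<open>0 < \<epsilon>\<close> \<open>0 < \<phi> b\<close> pick N n in \<open>auto intro!: mono \<tau>\<close>)
  have run: "scaled_compress_conv_dec \<phi> \<tau> \<kappa> pick \<epsilon> a b = Option.bind ?inc (\<lambda>r.
     Some ((\<lambda>(x, v). (- x, v)) ` fst r, snd r + card (fst r)))"
    by (simp add: scaled_compress_conv_dec_def andthen_def spend_def)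
  show ?thesis
  proof (intro conjI allI impI)
    assume "\<epsilon> \<le> 20"
    then show "scaled_compress_conv_dec \<phi> \<tau> \<kappa> pick \<epsilon> a b \<noteq> None"
      using inc unfolding run by auto
  next
    fix W T
    assume "scaled_compress_conv_dec \<phi> \<tau> \<kappa> pick \<epsilon> a b = Some (W, T)"
    then obtain V T0 where V: "?inc = Some (V, T0)" "W = (\<lambda>(x, v). (- x, v)) ` V" "T = T0 + card V"
      unfolding run by (cases ?inc) auto
    then obtain Z where Z: "V = rounded (\<lambda>x. \<phi> (- x)) \<epsilon> (\<phi> (- (- b))) ` ({- b, - a} \<union> Z)"
        "finite Z" "Z \<subseteq> {- b<..- a}" "card Z \<le> n"
        "T0 \<le> n * (2 * (N * (t + 2)) + t + 6) + 3 * t + n + 8"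
      and lattice: "\<forall>z\<in>Z. \<exists>k::int. z = scale_step \<kappa> \<epsilon> (\<phi> (- (- b))) * of_int k"
      and br: "\<forall>x\<in>{- b..- a}. \<exists>p\<in>insert (- b) Z. \<exists>q\<in>insert (- a) Z.
             p \<le> x \<and> x \<le> q \<and> \<phi> (- q) \<le> (1 + \<epsilon>) * \<phi> (- p)"
      using inc by blast
    have "W = rounded \<phi> \<epsilon> (\<phi> b) ` (uminus ` ({- b, - a} \<union> Z))"
      unfolding V(2) Z(1) rounded_def image_image by simp
    also have "uminus ` ({- b, - a} \<union> Z) = {a, b} \<union> uminus ` Z"
      by auto
    finally have W: "W = rounded \<phi> \<epsilon> (\<phi> b) ` ({a, b} \<union> uminus ` Z)" .
    have lattice': "\<exists>k::int. z = scale_step \<kappa> \<epsilon> (\<phi> b) * of_int k" if z: "z \<in> uminus ` Z" for z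
    proof -
      have "- z \<in> Z"
        using z by auto
      then obtain k :: int where "- z = scale_step \<kappa> \<epsilon> (\<phi> b) * of_int k"
        using lattice by (metis add.inverse_inverse)
      then show ?thesis
        by (intro exI[of _ "- k"]) simp
    qed
    have br': "\<exists>p\<in>insert a (uminus ` Z). \<exists>q\<in>insert b (uminus ` Z).
        p \<le> x \<and> x \<le> q \<and> \<phi> p \<le> (1 + \<epsilon>) * \<phi> q" if x: "x \<in> {a..b}" for x
    proof -
      have "- x \<in> {- b..- a}"
        using x by simp
      then obtain p q where pq: "p \<in> insert (- b) Z" "q \<in> insert (- a) Z" "p \<le> - x" "- x \<le> q"
          "\<phi> (- q) \<le> (1 + \<epsilon>) * \<phi> (- p)"
        using br by blast
      \<comment> \<open>Reflection exchanges the left and the right bracketing point.\<close>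
      then have "- q \<in> insert a (uminus ` Z)" "- p \<in> insert b (uminus ` Z)" "- q \<le> x" "x \<le> - p"
        by auto
      then show ?thesis
        using pq(5) by blast
    qed
    have "card V \<le> 2 + n"
    proof -
      have "card V \<le> card ({- b, - a} \<union> Z)"
        unfolding Z(1) using Z(2) by (intro card_image_le) simp
      also have "\<dots> \<le> card {- b, - a} + card Z"
        by (rule card_Un_le)
      also have "\<dots> \<le> 2 + n"
        using Z(4) by (simp add: card_insert_if)
      finally show ?thesis .
    qed
    then have "T \<le> n * (2 * (N * (t + 2)) + t + 6) + 3 * t + 2 * n + 10"
      using Z(5) V(3) by simp
    moreover have "uminus ` Z \<subseteq> {a..<b}"
      using Z(3) by force
    moreover have "card (uminus ` Z) \<le> n"
      using Z(2,4) card_image_le le_trans by blast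
    ultimately show "\<exists>Z. W = rounded \<phi> \<epsilon> (\<phi> b) ` ({a, b} \<union> Z) \<and> finite Z \<and> Z \<subseteq> {a..<b} \<and>
         (\<forall>z\<in>Z. \<exists>k::int. z = scale_step \<kappa> \<epsilon> (\<phi> b) * of_int k) \<and> card Z \<le> n \<and>
         (\<forall>x\<in>{a..b}. \<exists>p\<in>insert a Z. \<exists>q\<in>insert b Z. p \<le> x \<and> x \<le> q \<and> \<phi> p \<le> (1 + \<epsilon>) * \<phi> q) \<and>
         T \<le> n * (2 * (N * (t + 2)) + t + 6) + 3 * t + 2 * n + 10"
      using W Z(2) lattice' br' by (intro exI[of _ "uminus ` Z"] conjI ballI) auto
  qed
qed


section \<open>The combined routine\<close>

text \<open>Injectivity of \<open>fst\<close> on \<open>W\<close> means that the keys are distinct,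
  so sorting by key loses no pair and the order of the keys is strict.\<close>

lemma (in linorder) sorted_key_list_of_set_fst:
  fixes W :: "('a \<times> 'b) set"
  assumes "inj_on fst W" "finite W"
  shows "set (sorted_key_list_of_set fst W) = W"
    and "sorted_wrt (<) (map fst (sorted_key_list_of_set fst W))"
    and "length (sorted_key_list_of_set fst W) = card W"
proof -
  interpret F: folding_insort_key "(\<le>)" "(<)" W fst
    by unfold_locales (fact assms(1))
  show "set (sorted_key_list_of_set fst W) = W"
    by (rule F.set_sorted_key_list_of_set[OF subset_refl assms(2)])
  show "sorted_wrt (<) (map fst (sorted_key_list_of_set fst W))"
    by (rule F.strict_sorted_key_list_of_set[OF subset_refl])
  show "length (sorted_key_list_of_set fst W) = card W"
    by (rule F.length_sorted_key_list_of_set[OF subset_refl])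
qed

text \<open>The extension induced by the two points \<open>p\<close> and \<open>q\<close> lies
  between the two sides.\<close>

lemma convex_on_le_max:
  fixes \<phi> :: "real \<Rightarrow> real"
  assumes "convex_on D \<phi>" "p \<in> D" "q \<in> D" "p \<le> x" "x \<le> q"
  shows "\<phi> x \<le> max (\<phi> p) (\<phi> q)"
  using convex_extension_bounds[of D \<phi> "{p, q}" p q x] assms by force

text \<open>Convexity makes \<open>\<phi>\<close> monotone on either side of the minimizer. Both
  halves have minimum \<open>\<phi> xs\<close>, so the two routines use the same scaling and
  rounding and share the budgets \<open>n\<close> and \<open>N\<close>.\<close>

lemma scaled_compress_conv_spec:
  assumes conv: "convex_on {A..B} \<phi>" and lip: "lipschitz_on \<kappa> {A..B} \<phi>"
    and "0 < \<kappa>" and "0 < \<epsilon>" and xs: "xs \<in> {A..B}" and "0 < \<phi> xs"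
    and arg_min: "\<And>z. z \<in> {A..B} \<Longrightarrow> \<phi> xs \<le> \<phi> z"
    and \<tau>: "\<And>z. z \<in> {A..B} \<Longrightarrow> \<tau> z \<le> t" and pick: "picks_integer pick"
    and N: "10 * \<kappa> * (B - A) \<le> 2 ^ N * (\<epsilon> * \<phi> xs)"
    and n: "\<phi> A < (1 + 3/10 * \<epsilon>) ^ n * \<phi> xs" "\<phi> B < (1 + 3/10 * \<epsilon>) ^ n * \<phi> xs"
  shows "(\<epsilon> \<le> 20 \<longrightarrow> scaled_compress_conv \<phi> \<tau> \<kappa> pick \<epsilon> A B xs tx \<noteq> None) \<and>
    (\<forall>R T. scaled_compress_conv \<phi> \<tau> \<kappa> pick \<epsilon> A B xs tx = Some (R, T) \<longrightarrow>
      (\<exists>Z. set R = rounded \<phi> \<epsilon> (\<phi> xs) ` ({A, B} \<union> Z) \<and> sorted_wrt (<) (map fst R) \<and>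
         length R \<le> 2 * n + 2 \<and> finite Z \<and> Z \<subseteq> {A..B} \<and>
         (\<forall>z\<in>Z. \<exists>k::int. z = scale_step \<kappa> \<epsilon> (\<phi> xs) * of_int k) \<and>
         bracketing (1 + \<epsilon>) \<phi> A B ({A, B} \<union> Z) \<and>
         T \<le> tx + 2 * (n * (2 * (N * (t + 2)) + t + 6) + 3 * t + 2 * n + 10) + t + 1 +
              (2 * n + 4) * (1 + ceillog2 (2 * n + 4))))"
proof -
  let ?r = "rounded \<phi> \<epsilon> (\<phi> xs)"
  let ?dec = "scaled_compress_conv_dec \<phi> \<tau> \<kappa> pick \<epsilon> A xs"
  let ?inc = "scaled_compress_conv_inc \<phi> \<tau> \<kappa> pick \<epsilon> xs B"
  have sub: "{A..xs} \<subseteq> {A..B}" "{xs..B} \<subseteq> {A..B}"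
    using xs by auto
  have incr: "\<phi> v \<le> \<phi> w" if "xs \<le> v" "v \<le> w" "w \<le> B" for v w
    using convex_on_le_max[OF conv xs, of w v] arg_min[of w] that xs by auto
  have decr: "\<phi> w \<le> \<phi> v" if "A \<le> v" "v \<le> w" "w \<le> xs" for v w
    using convex_on_le_max[OF conv _ xs, of v w] arg_min[of v] that xs by auto
  have "10 * \<kappa> * (xs - A) \<le> 10 * \<kappa> * (B - A)" "10 * \<kappa> * (B - xs) \<le> 10 * \<kappa> * (B - A)"
    using xs \<open>0 < \<kappa>\<close> by (auto intro!: mult_left_mono)
  then have N': "10 * \<kappa> * (xs - A) \<le> 2 ^ N * (\<epsilon> * \<phi> xs)" "10 * \<kappa> * (B - xs) \<le> 2 ^ N * (\<epsilon> * \<phi> xs)"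
    using N by linarith+
  have dec: "(\<epsilon> \<le> 20 \<longrightarrow> ?dec \<noteq> None) \<and>
    (\<forall>W T. ?dec = Some (W, T) \<longrightarrow>
      (\<exists>Z. W = ?r ` ({A, xs} \<union> Z) \<and> finite Z \<and> Z \<subseteq> {A..<xs} \<and>
         (\<forall>z\<in>Z. \<exists>k::int. z = scale_step \<kappa> \<epsilon> (\<phi> xs) * of_int k) \<and> card Z \<le> n \<and>
         (\<forall>x\<in>{A..xs}. \<exists>p\<in>insert A Z. \<exists>q\<in>insert xs Z.
             p \<le> x \<and> x \<le> q \<and> \<phi> p \<le> (1 + \<epsilon>) * \<phi> q) \<and>
         T \<le> n * (2 * (N * (t + 2)) + t + 6) + 3 * t + 2 * n + 10))"
    using xs decr lipschitz_on_subset[OF lip sub(1)] \<open>0 < \<kappa>\<close> \<open>0 < \<epsilon>\<close> \<open>0 < \<phi> xs\<close> \<tau> pick N'(1) n(1)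
    by (intro scaled_compress_conv_dec_spec) auto
  have inc: "(\<epsilon> \<le> 20 \<longrightarrow> ?inc \<noteq> None) \<and>
    (\<forall>W T. ?inc = Some (W, T) \<longrightarrow>
      (\<exists>Z. W = ?r ` ({xs, B} \<union> Z) \<and> finite Z \<and> Z \<subseteq> {xs<..B} \<and>
         (\<forall>z\<in>Z. \<exists>k::int. z = scale_step \<kappa> \<epsilon> (\<phi> xs) * of_int k) \<and> card Z \<le> n \<and>
         (\<forall>x\<in>{xs..B}. \<exists>p\<in>insert xs Z. \<exists>q\<in>insert B Z.
             p \<le> x \<and> x \<le> q \<and> \<phi> q \<le> (1 + \<epsilon>) * \<phi> p) \<and>
         T \<le> n * (2 * (N * (t + 2)) + t + 6) + 3 * t + n + 8))"
    using xs incr lipschitz_on_subset[OF lip sub(2)] \<open>0 < \<kappa>\<close> \<open>0 < \<epsilon>\<close> \<open>0 < \<phi> xs\<close> \<tau> pick N'(2) n(2)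
    by (intro scaled_compress_conv_inc_spec) auto
  have run: "scaled_compress_conv \<phi> \<tau> \<kappa> pick \<epsilon> A B xs tx =
     Option.bind ?dec (\<lambda>r\<^sub>A. Option.bind ?inc (\<lambda>r\<^sub>B.
       let W = (fst r\<^sub>A \<union> fst r\<^sub>B) - (if A < xs \<and> xs < B then {?r xs} else {});
           l = card (fst r\<^sub>A \<union> fst r\<^sub>B)
       in Some (sorted_key_list_of_set fst W,
            tx + (snd r\<^sub>A + (snd r\<^sub>B + (\<tau> xs + 1 + l * (1 + ceillog2 l)))))))"
    by (cases ?dec; cases ?inc)
      (simp_all add: scaled_compress_conv_def andthen_def spend_def Let_def rounded_def)
  show ?thesis
  proof (intro conjI allI impI)
    assume "\<epsilon> \<le> 20"
    then show "scaled_compress_conv \<phi> \<tau> \<kappa> pick \<epsilon> A B xs tx \<noteq> None"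
      using dec inc unfolding run by (auto simp: Let_def)
  next
    fix R T
    assume "scaled_compress_conv \<phi> \<tau> \<kappa> pick \<epsilon> A B xs tx = Some (R, T)"
    then obtain W\<^sub>A T\<^sub>A W\<^sub>B T\<^sub>B where WA: "?dec = Some (W\<^sub>A, T\<^sub>A)" and WB: "?inc = Some (W\<^sub>B, T\<^sub>B)"
      and R: "R = sorted_key_list_of_set fst
                 ((W\<^sub>A \<union> W\<^sub>B) - (if A < xs \<and> xs < B then {?r xs} else {}))"
      and T: "T = tx + (T\<^sub>A + (T\<^sub>B +
                 (\<tau> xs + 1 + card (W\<^sub>A \<union> W\<^sub>B) * (1 + ceillog2 (card (W\<^sub>A \<union> W\<^sub>B))))))"
      unfolding run by (cases ?dec; cases ?inc) (auto simp: Let_def)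
    obtain Y where Y: "W\<^sub>A = ?r ` ({A, xs} \<union> Y)" "finite Y" "Y \<subseteq> {A..<xs}" "card Y \<le> n"
        "\<forall>z\<in>Y. \<exists>k::int. z = scale_step \<kappa> \<epsilon> (\<phi> xs) * of_int k"
        "T\<^sub>A \<le> n * (2 * (N * (t + 2)) + t + 6) + 3 * t + 2 * n + 10"
      and br\<^sub>A: "\<forall>x\<in>{A..xs}. \<exists>p\<in>insert A Y. \<exists>q\<in>insert xs Y.
             p \<le> x \<and> x \<le> q \<and> \<phi> p \<le> (1 + \<epsilon>) * \<phi> q"
      using dec WA by blast
    obtain Z where Z: "W\<^sub>B = ?r ` ({xs, B} \<union> Z)" "finite Z" "Z \<subseteq> {xs<..B}" "card Z \<le> n"
        "\<forall>z\<in>Z. \<exists>k::int. z = scale_step \<kappa> \<epsilon> (\<phi> xs) * of_int k"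
        "T\<^sub>B \<le> n * (2 * (N * (t + 2)) + t + 6) + 3 * t + n + 8"
      and br\<^sub>B: "\<forall>x\<in>{xs..B}. \<exists>p\<in>insert xs Z. \<exists>q\<in>insert B Z.
             p \<le> x \<and> x \<le> q \<and> \<phi> q \<le> (1 + \<epsilon>) * \<phi> p"
      using inc WB by blast
    let ?E = "{A, B} \<union> (Y \<union> Z)"
    have inj_r: "inj ?r"
      by (auto simp: rounded_def inj_on_def)
    \<comment> \<open>Both routines record the same pair at \<open>xs\<close>, and \<open>?r\<close>
      is injective, so one deletion removes exactly the point \<open>xs\<close>. If nothing is
      deleted, \<open>xs\<close> is one of the endpoints in \<open>?E\<close>.\<close>
    have W: "(W\<^sub>A \<union> W\<^sub>B) - (if A < xs \<and> xs < B then {?r xs} else {}) = ?r ` ?E"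
    proof (cases "A < xs \<and> xs < B")
      case True
      have "(W\<^sub>A \<union> W\<^sub>B) - {?r xs} = ?r ` (({A, xs} \<union> Y \<union> ({xs, B} \<union> Z)) - {xs})"
        unfolding Y(1) Z(1) image_set_diff[OF inj_r] by (simp add: image_Un)
      also have "({A, xs} \<union> Y \<union> ({xs, B} \<union> Z)) - {xs} = ?E"
        using True Y(3) Z(3) by auto
      finally show ?thesis
        using True by simp
    next
      case False
      then have "xs = A \<or> xs = B"
        using xs by auto
      then show ?thesis
        unfolding Y(1) Z(1) using False by (auto simp: image_Un)
    qed
    have fin: "finite ?E"
      using Y(2) Z(2) by simp
    have "inj_on fst (?r ` ?E)"
      by (auto simp: rounded_def inj_on_def)
    then have R': "set R = ?r ` ?E" "sorted_wrt (<) (map fst R)" "length R = card (?r ` ?E)"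
      using sorted_key_list_of_set_fst[of "?r ` ?E"] fin unfolding R W by simp_all
    have "card (Y \<union> Z) \<le> n + n"
      using Y(4) Z(4) by (intro order_trans[OF card_Un_le] add_mono)
    then have card_E: "card ?E \<le> 2 * n + 2"
      using card_Un_le[of "{A, B}" "Y \<union> Z"] card_insert_if[of "{B}" A] by (simp split: if_splits)
    have "length R \<le> 2 * n + 2"
      using card_image_le[OF fin, of ?r] card_E R'(3) by linarith
    moreover have "Y \<union> Z \<subseteq> {A..B}"
      using Y(3) Z(3) xs by auto
    moreover have "bracketing (1 + \<epsilon>) \<phi> A B ?E"
      unfolding bracketing_def
    proof
      fix x assume x: "x \<in> {A..B}"
      have scale: "(1 + \<epsilon>) * \<phi> v \<le> (1 + \<epsilon>) * \<phi> w" if "\<phi> v \<le> \<phi> w" for v w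
        using that \<open>0 < \<epsilon>\<close> by simp
      have self: "\<phi> w \<le> (1 + \<epsilon>) * \<phi> w" if "w \<in> {A..B}" for w
        using arg_min[OF that] \<open>0 < \<epsilon>\<close> \<open>0 < \<phi> xs\<close> by simp
      \<comment> \<open>A substitute for \<open>xs\<close> on its left: in the bracket of
        \<open>xs\<close> itself the right point can only be \<open>xs\<close>, because
        \<open>Y\<close> lies strictly to the left. \<open>q\<^sub>0\<close> is the counterpart on
        the right.\<close>
      obtain p\<^sub>0 where p\<^sub>0: "p\<^sub>0 \<in> ?E" "p\<^sub>0 \<le> xs" "\<phi> p\<^sub>0 \<le> (1 + \<epsilon>) * \<phi> xs"
      proof -
        obtain p q where "p \<in> insert A Y" "q \<in> insert xs Y" "p \<le> xs" "xs \<le> q" "\<phi> p \<le> (1 + \<epsilon>) * \<phi> q"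
          using br\<^sub>A xs by fastforce
        moreover from this have "q = xs"
          using Y(3) by auto
        ultimately show thesis
          using that[of p] by blast
      qed
      obtain q\<^sub>0 where q\<^sub>0: "q\<^sub>0 \<in> ?E" "xs \<le> q\<^sub>0" "\<phi> q\<^sub>0 \<le> (1 + \<epsilon>) * \<phi> xs"
      proof -
        obtain p q where "p \<in> insert xs Z" "q \<in> insert B Z" "p \<le> xs" "xs \<le> q" "\<phi> q \<le> (1 + \<epsilon>) * \<phi> p"
          using br\<^sub>B xs by fastforce
        moreover from this have "p = xs"
          using Z(3) by auto
        ultimately show thesis
          using that[of q] by blast
      qed
      show "\<exists>p\<in>?E. \<exists>q\<in>?E. p \<le> x \<and> x \<le> q \<and> \<phi> p \<le> (1 + \<epsilon>) * \<phi> x \<and> \<phi> q \<le> (1 + \<epsilon>) * \<phi> x"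
      proof (cases "xs \<le> x")
        case True
        then obtain p q where pq: "p \<in> insert xs Z" "q \<in> insert B Z" "p \<le> x" "x \<le> q"
            "\<phi> q \<le> (1 + \<epsilon>) * \<phi> p"
          using br\<^sub>B x by (meson atLeastAtMost_iff)
        have "xs \<le> p"
          using pq(1) Z(3) by auto
        then have px: "\<phi> p \<le> \<phi> x"
          using pq(3) x incr by simp
        have q: "q \<in> ?E" "\<phi> q \<le> (1 + \<epsilon>) * \<phi> x"
          using pq(2,5) scale[OF px] by auto
        show ?thesis
        proof (cases "p = xs")
          \<comment> \<open>The left point may have been deleted. \<open>p\<^sub>0\<close> replaces
            it, since its value is at most \<open>(1 + \<epsilon>) * \<phi> xs\<close> and
            \<open>\<phi> xs \<le> \<phi> x\<close>.\<close>
          case True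
          then have "p\<^sub>0 \<le> x" "\<phi> p\<^sub>0 \<le> (1 + \<epsilon>) * \<phi> x"
            using p\<^sub>0(2,3) \<open>xs \<le> x\<close> scale[OF px] by auto
          then show ?thesis
            using q p\<^sub>0(1) pq(4) by blast
        next
          case False
          then have "p \<in> ?E" "\<phi> p \<le> (1 + \<epsilon>) * \<phi> x"
            using pq(1) self[of x] x px by auto
          then show ?thesis
            using q pq(3,4) by blast
        qed
      next
        case False
        then have "x \<in> {A..xs}"
          using x by simp
        then obtain p q where pq: "p \<in> insert A Y" "q \<in> insert xs Y" "p \<le> x" "x \<le> q"
            "\<phi> p \<le> (1 + \<epsilon>) * \<phi> q"
          using br\<^sub>A by blast
        have "q \<le> xs"
          using pq(2) Y(3) by auto
        then have qx: "\<phi> q \<le> \<phi> x"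
          using pq(4) x decr by simp
        have p: "p \<in> ?E" "\<phi> p \<le> (1 + \<epsilon>) * \<phi> x"
          using pq(1,5) scale[OF qx] by auto
        show ?thesis
        proof (cases "q = xs")
          case True
          then have "x \<le> q\<^sub>0" "\<phi> q\<^sub>0 \<le> (1 + \<epsilon>) * \<phi> x"
            using q\<^sub>0(2,3) False scale[OF qx] by auto
          then show ?thesis
            using p q\<^sub>0(1) pq(3) by blast
        next
          case False
          then have "q \<in> ?E" "\<phi> q \<le> (1 + \<epsilon>) * \<phi> x"
            using pq(2) self[of x] x qx by auto
          then show ?thesis
            using p pq(3,4) by blast
        qed
      qed
    qed
    moreover have "T \<le> tx + 2 * (n * (2 * (N * (t + 2)) + t + 6) + 3 * t + 2 * n + 10) + t + 1 +
              (2 * n + 4) * (1 + ceillog2 (2 * n + 4))"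
    proof -
      \<comment> \<open>The cost of sorting is charged for the union before the deletion, hence the
        extra point \<open>xs\<close>.\<close>
      have "W\<^sub>A \<union> W\<^sub>B \<subseteq> ?r ` insert xs ?E"
        unfolding Y(1) Z(1) by auto
      then have "card (W\<^sub>A \<union> W\<^sub>B) \<le> card (?r ` insert xs ?E)"
        using fin by (intro card_mono) auto
      also have "\<dots> \<le> card (insert xs ?E)"
        using fin by (intro card_image_le) auto
      also have "\<dots> \<le> Suc (card ?E)"
        by (rule card_insert_le_m1) auto
      also have "\<dots> \<le> 2 * n + 4"
        using card_E by linarith
      finally have "card (W\<^sub>A \<union> W\<^sub>B) * (1 + ceillog2 (card (W\<^sub>A \<union> W\<^sub>B)))
          \<le> (2 * n + 4) * (1 + ceillog2 (2 * n + 4))" (is "?sort \<le> ?sort'")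
        by (intro mult_le_mono add_le_mono ceillog2_mono order_refl)
      moreover have "\<tau> xs \<le> t"
        using \<tau> xs by simp
      \<comment> \<open>Naming the nonlinear bound leaves a linear problem; \<open>T\<^sub>B\<close>
        is weakened to the same bound as \<open>T\<^sub>A\<close>.\<close>
      moreover define X where "X = n * (2 * (N * (t + 2)) + t + 6) + 3 * t + 2 * n + 10"
      moreover have "T\<^sub>A \<le> X"
        unfolding X_def by (rule Y(6))
      moreover have "T\<^sub>B \<le> X"
        unfolding X_def by (rule order_trans[OF Z(6)], intro add_mono) simp_all
      ultimately show ?thesis
        unfolding T X_def[symmetric] by linarith
    qed
    ultimately show "\<exists>Z. set R = ?r ` ({A, B} \<union> Z) \<and> sorted_wrt (<) (map fst R) \<and>
         length R \<le> 2 * n + 2 \<and> finite Z \<and> Z \<subseteq> {A..B} \<and>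
         (\<forall>z\<in>Z. \<exists>k::int. z = scale_step \<kappa> \<epsilon> (\<phi> xs) * of_int k) \<and>
         bracketing (1 + \<epsilon>) \<phi> A B ({A, B} \<union> Z) \<and>
         T \<le> tx + 2 * (n * (2 * (N * (t + 2)) + t + 6) + 3 * t + 2 * n + 10) + t + 1 +
              (2 * n + 4) * (1 + ceillog2 (2 * n + 4))"
      using R'(1,2) Y(2,5) Z(2,5) by (intro exI[of _ "Y \<union> Z"] conjI) auto
  qed
qed


section \<open>Logarithmic bounds\<close>

lemma Olog_ge_1: "1 \<le> Olog b x"
  by (simp add: Olog_def)

lemma log_le_Olog: "log b x \<le> Olog b x"
  by (simp add: Olog_def)

text \<open>Moving the maximum inside makes product and monotonicity rules of the logarithm
  applicable. The case \<open>x = 0\<close> rests on the default value of the logarithm at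
  0.\<close>

lemma Olog_2_eq: "0 \<le> x \<Longrightarrow> Olog 2 x = log 2 (max 2 x)"
proof (cases "x = 0")
  case False
  then show "0 \<le> x \<Longrightarrow> Olog 2 x = log 2 (max 2 x)"
    by (cases "x \<le> 2") (auto simp: Olog_def max_def not_le)
qed (simp add: Olog_def log_def)

lemma exists_power_gt_Olog:
  assumes "0 < \<epsilon>" "1 \<le> r"
  obtains n where "r < (1 + 3/10 * \<epsilon>) ^ n" "real n \<le> 8 * Olog (1 + \<epsilon>) r"
proof -
  let ?l = "log (1 + \<epsilon>) r"
  \<comment> \<open>Floor plus one, not the ceiling, keeps the inequality strict when
    \<open>?l\<close> is an integer.\<close>
  define k where "k = nat \<lfloor>?l\<rfloor> + 1"
  have l: "0 \<le> ?l"
    using assms by simp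
  have "r = (1 + \<epsilon>) powr ?l"
    using assms by simp
  also have "\<dots> < (1 + \<epsilon>) powr real k"
    using assms l by (intro powr_less_mono) (auto simp: k_def, linarith)
  also have "\<dots> = (1 + \<epsilon>) ^ k"
    using assms by (simp add: powr_realpow)
  \<comment> \<open>By Bernoulli's inequality four steps gain at least
    \<open>1 + 12/10 * \<epsilon>\<close>, which exceeds \<open>1 + \<epsilon>\<close>.\<close>
  also have "\<dots> \<le> ((1 + 3/10 * \<epsilon>) ^ 4) ^ k"
    using Bernoulli_inequality[of "3/10 * \<epsilon>" 4] assms by (intro power_mono) auto
  finally have "r < (1 + 3/10 * \<epsilon>) ^ (4 * k)"
    by (simp only: power_mult)
  moreover have "real k \<le> ?l + 1"
    using l by (simp add: k_def)
  then have "real (4 * k) \<le> 8 * Olog (1 + \<epsilon>) r"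
    using log_le_Olog[of "1 + \<epsilon>" r] Olog_ge_1[of "1 + \<epsilon>" r] by simp
  ultimately show thesis
    using that by blast
qed

text \<open>Replacing 10 by \<open>2 ^ 4\<close> costs four halvings and rounding up costs one; the
  logarithm is at least 1, so the total is within a factor 6.\<close>

lemma exists_power2_ge_Olog:
  assumes "0 \<le> x"
  obtains N where "10 * x \<le> 2 ^ N" "real N \<le> 6 * Olog 2 x"
proof -
  let ?l = "log 2 (max 2 x)"
  have l: "1 \<le> ?l"
    by (simp add: le_log_iff)
  obtain k where k: "?l \<le> real k" "real k \<le> ?l + 1"
    using l by (intro that[of "nat \<lceil>?l\<rceil>"]) linarith+
  have "10 * x \<le> 16 * max 2 x"
    using assms by (auto simp: max_def)
  also have "max 2 x = 2 powr ?l"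
    by (simp add: max_def)
  also have "\<dots> \<le> 2 powr real k"
    using k(1) by (intro powr_mono) auto
  also have "16 * \<dots> = 2 ^ (k + 4)"
    by (simp add: powr_realpow power_add)
  finally have "10 * x \<le> 2 ^ (k + 4)"
    by simp
  moreover have "real (k + 4) \<le> 6 * Olog 2 x"
    unfolding Olog_2_eq[OF assms] using k(2) l by linarith
  ultimately show thesis
    using that by blast
qed

text \<open>The number of pairs is linear in \<open>x = \<kappa> (B - A) / (\<epsilon> \<phi>min)\<close> because of Bernoulli's
  inequality, so the logarithmic factor of sorting is absorbed by that of the binary search.\<close>

lemma Olog_linear_bound:
  assumes "0 < \<epsilon>" "1 \<le> r" "r \<le> 1 + \<epsilon> * x"
  shows "Olog (1 + \<epsilon>) r \<le> 2 * max 1 x"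
proof -
  let ?k = "nat \<lceil>x\<rceil>"
  have "\<epsilon> * x \<le> \<epsilon> * real ?k"
    using \<open>0 < \<epsilon>\<close> by (intro mult_left_mono real_nat_ceiling_ge) auto
  then have "r \<le> 1 + real ?k * \<epsilon>"
    using assms(3) by (simp add: mult.commute)
  also have "\<dots> \<le> (1 + \<epsilon>) ^ ?k"
    using Bernoulli_inequality[of \<epsilon> ?k] \<open>0 < \<epsilon>\<close> by simp
  finally have "log (1 + \<epsilon>) r \<le> real ?k"
    using assms(1,2) by (simp add: log_le_iff powr_realpow)
  moreover have "real ?k \<le> 2 * max 1 x"
    by linarith
  ultimately show ?thesis
    by (simp add: Olog_def)
qed

text \<open>The linear bound on \<open>l\<close> gives \<open>log 2 l \<le> 6 + Olog 2 x\<close>.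
  Adding 1 for rounding and 1 for the summand keeps the second factor within
  \<open>9 * Olog 2 x\<close>, and \<open>180 = 20 * 9\<close>.\<close>

lemma sort_bound:
  assumes "0 < \<epsilon>" "1 \<le> r" "r \<le> 1 + \<epsilon> * x" "0 < l" "real l \<le> 20 * Olog (1 + \<epsilon>) r" "0 \<le> x"
  shows "real (l * (1 + ceillog2 l)) \<le> 180 * (Olog 2 x * Olog (1 + \<epsilon>) r)"
proof -
  have "real l \<le> 40 * max 1 x"
    using Olog_linear_bound[OF assms(1-3)] assms(5) by linarith
  also have "\<dots> \<le> 64 * max 2 x"
    by linarith
  finally have "log 2 (real l) \<le> log 2 (64 * max 2 x)"
    using assms(4) by (intro log_mono) auto
  also have "\<dots> = 6 + Olog 2 x"
  proof -
    have "log 2 64 = log 2 (2 ^ 6 :: real)"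
      by simp
    also have "\<dots> = 6"
      by (subst log_nat_power) auto
    finally show ?thesis
      using assms(6) by (subst log_mult) (auto simp: Olog_2_eq)
  qed
  finally have "real (1 + ceillog2 l) \<le> 9 * Olog 2 x"
    using ceillog2_less_log[OF assms(4)] Olog_ge_1[of 2 x] by simp
  then have "real l * real (1 + ceillog2 l) \<le> (20 * Olog (1 + \<epsilon>) r) * (9 * Olog 2 x)"
    using assms(5) Olog_ge_1[of "1 + \<epsilon>" r] by (intro mult_mono) auto
  then show ?thesis
    by (simp only: of_nat_mult mult_ac)
qed

section \<open>Bit lengths of the stored multipliers\<close>

lemma representableI:
  assumes "x = u * of_int k" "Olog 2 \<bar>of_int k\<bar> + 3 \<le> n"
  shows "representable u n x"
proof -
  \<comment> \<open>The 3 additional bits are this factor 2, the ceiling and the sign.\<close>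
  have "log 2 (\<bar>of_int k\<bar> + 1) \<le> log 2 (2 * max 2 \<bar>real_of_int k\<bar>)"
    by (intro log_mono) auto
  also have "\<dots> = 1 + Olog 2 \<bar>of_int k\<bar>"
    by (subst log_mult) (auto simp: Olog_2_eq)
  finally show ?thesis
    unfolding representable_def using assms by (intro exI[of _ k]) linarith
qed

lemma log_2_mult: "0 < x \<Longrightarrow> 0 < y \<Longrightarrow> log 2 (x * y) = log 2 x + log 2 (y :: real)"
  by (simp add: log_mult)

lemma log_2_128: "log 2 128 = (7 :: real)"
proof -
  have "log 2 128 = log 2 (2 ^ 7 :: real)"
    by simp
  then show ?thesis
    by (subst (asm) log_nat_power) auto
qed

context
  fixes A B \<kappa> \<epsilon> m M \<delta> space C :: real
  assumes pos: "0 < \<kappa>" "0 < \<epsilon>" "0 < m" "m \<le> M"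
    and \<delta>: "0 \<le> \<delta>" "log 2 (1 / M) \<le> \<delta>" and C: "11 \<le> C"
    and space: "space = Olog 2 (1 / \<epsilon>) + Olog 2 (M / m) + Olog 2 \<kappa> + Olog 2 \<bar>A\<bar> + Olog 2 \<bar>B\<bar> + \<delta>"
begin

text \<open>It suffices to prove the space bounds with factor 11. The five logarithms in
  \<open>space\<close> are each at least 1, which absorbs the additive constants.\<close>

lemma space_mono: "11 * space \<le> C * space"
proof (rule mult_right_mono[OF C])
  show "0 \<le> space"
    unfolding space using \<delta>(1) by (intro add_nonneg_nonneg order_trans[OF zero_le_one Olog_ge_1])
qed

lemmas Olog_ge_1_parts =
  Olog_ge_1[of 2 "1 / \<epsilon>"] Olog_ge_1[of 2 "M / m"] Olog_ge_1[of 2 \<kappa>]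
  Olog_ge_1[of 2 "\<bar>A\<bar>"] Olog_ge_1[of 2 "\<bar>B\<bar>"]

lemma representable_endpoint:
  assumes "x = of_int k" "x = A \<or> x = B"
  shows "representable 1 (C * space) x"
proof (rule representableI)
  have "Olog 2 \<bar>x\<bar> = Olog 2 \<bar>A\<bar> \<or> Olog 2 \<bar>x\<bar> = Olog 2 \<bar>B\<bar>"
    using assms(2) by (elim disjE) simp_all
  then show "Olog 2 \<bar>of_int k\<bar> + 3 \<le> C * space"
    using space_mono space Olog_ge_1_parts \<delta>(1) unfolding assms(1) by linarith
qed (simp add: assms(1))

text \<open>Dividing by the step gives the multiplier
  \<open>100 * \<kappa> * x / (\<epsilon>\<^sup>2 * m)\<close>. Writing \<open>1 / m\<close> as
  \<open>(M / m) * (1 / M)\<close> turns its logarithm into terms of \<open>space\<close>, with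
  \<open>1 / M\<close> charged to \<open>\<delta>\<close> and \<open>1 / \<epsilon>\<close> counted
  twice.\<close>

lemma representable_lattice_point:
  assumes "x = scale_step \<kappa> \<epsilon> m * of_int k" "A \<le> x" "x \<le> B"
  shows "representable (scale_step \<kappa> \<epsilon> m) (C * space) x"
proof (rule representableI[OF assms(1)])
  have "Olog 2 \<bar>of_int k\<bar> \<le> 7 + 2 * space"
  \<comment> \<open>Splitting the logarithm of the product needs positive factors, hence
    \<open>x \<noteq> 0\<close>.\<close>
  proof (cases "k = 0")
    case True
    then have "Olog 2 \<bar>of_int k\<bar> = 1"
      by (simp add: Olog_2_eq)
    then show ?thesis
      using space Olog_ge_1_parts \<delta>(1) by linarith
  next
    case False
    have k: "\<bar>real_of_int k\<bar> = 100 * (\<bar>x\<bar> * (\<kappa> * ((1 / \<epsilon>) * ((1 / \<epsilon>) * ((M / m) * (1 / M))))))"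
      unfolding assms(1) using pos by (simp add: scale_step_def abs_mult power2_eq_square)
    have pos': "0 < (100 :: real)" "0 < \<bar>x\<bar>" "0 < 1 / \<epsilon>" "0 < M / m" "0 < 1 / M"
      using pos False by (auto simp: assms(1) scale_step_def)
    have "log 2 \<bar>of_int k\<bar> = log 2 100 + (log 2 \<bar>x\<bar> + (log 2 \<kappa> + (log 2 (1 / \<epsilon>)
        + (log 2 (1 / \<epsilon>) + (log 2 (M / m) + log 2 (1 / M))))))"
      unfolding k by (simp only: log_2_mult mult_pos_pos pos' pos(1))
    moreover have "log 2 100 \<le> log 2 (128 :: real)"
      by (intro log_mono) auto
    moreover have "log 2 \<bar>x\<bar> \<le> Olog 2 \<bar>A\<bar> \<or> log 2 \<bar>x\<bar> \<le> Olog 2 \<bar>B\<bar>"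
    proof -
      have "\<bar>x\<bar> \<le> \<bar>A\<bar> \<or> \<bar>x\<bar> \<le> \<bar>B\<bar>"
        using assms(2,3) by linarith
      then have "log 2 \<bar>x\<bar> \<le> log 2 \<bar>A\<bar> \<or> log 2 \<bar>x\<bar> \<le> log 2 \<bar>B\<bar>"
        using pos'(2) by (auto intro: log_mono)
      then show ?thesis
        using log_le_Olog order_trans by blast
    qed
    ultimately have "log 2 \<bar>of_int k\<bar> \<le> 7 + 2 * space"
      using space Olog_ge_1_parts \<delta> log_2_128 log_le_Olog[of 2 "1 / \<epsilon>"] log_le_Olog[of 2 "M / m"]
        log_le_Olog[of 2 \<kappa>] by linarith
    moreover have "1 \<le> 7 + 2 * space"
      using space Olog_ge_1_parts \<delta>(1) by linarith
    ultimately show ?thesis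
      by (simp only: Olog_def max.bounded_iff simp_thms)
  qed
  then show "Olog 2 \<bar>of_int k\<bar> + 3 \<le> C * space"
    using space_mono space Olog_ge_1_parts \<delta>(1) by linarith
qed

text \<open>The multiplier is at most about \<open>10 * (1 / \<epsilon>) * (M / m)\<close>.
  Enlarging 10 to 128 absorbs the rounding, because the truncated factors \<open>e\<close> and
  \<open>r\<close> are at least 2.\<close>

lemma representable_value:
  assumes "0 \<le> y" "y \<le> M"
  shows "representable (\<epsilon> * m / 10) (C * space) (\<epsilon> * m / 10 * of_int \<lceil>10 * y / (\<epsilon> * m)\<rceil>)"
proof (rule representableI[OF refl])
  define e where "e = max 2 (1 / \<epsilon>)"
  define r where "r = max 2 (M / m)"
  have er: "2 \<le> e" "1 / \<epsilon> \<le> e" "2 \<le> r" "M / m \<le> r"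
    by (simp_all add: e_def r_def)
  have "10 * y / (\<epsilon> * m) \<le> 10 * M / (\<epsilon> * m)"
    using assms pos by (intro divide_right_mono) auto
  also have "\<dots> = 10 * ((1 / \<epsilon>) * (M / m))"
    by simp
  also have "\<dots> \<le> 10 * (e * r)"
    using pos er by (intro mult_left_mono mult_mono) auto
  finally have le: "10 * y / (\<epsilon> * m) \<le> 10 * (e * r)" .
  have "2 * 2 \<le> e * r"
    using er by (intro mult_mono) auto
  moreover have "0 \<le> 10 * y / (\<epsilon> * m)"
    using assms pos by simp
  ultimately have "max 2 \<bar>of_int \<lceil>10 * y / (\<epsilon> * m)\<rceil>\<bar> \<le> 128 * (e * r)"
    using le by linarith
  then have "Olog 2 \<bar>of_int \<lceil>10 * y / (\<epsilon> * m)\<rceil>\<bar> \<le> log 2 (128 * (e * r))"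
    unfolding Olog_2_eq[OF abs_ge_zero] by (intro log_mono) auto
  also have "\<dots> = 7 + (log 2 e + log 2 r)"
    using er(1,3) by (simp add: log_2_mult log_2_128 mult_pos_pos)
  also have "\<dots> = 7 + (Olog 2 (1 / \<epsilon>) + Olog 2 (M / m))"
    using pos by (simp add: Olog_2_eq e_def r_def)
  finally show "Olog 2 \<bar>of_int \<lceil>10 * y / (\<epsilon> * m)\<rceil>\<bar> + 3 \<le> C * space"
    using space_mono space Olog_ge_1_parts \<delta>(1) by linarith
qed

end

section \<open>Collecting the running time\<close>

lemma time_bound:
  assumes "1 \<le> t" "1 \<le> a" "1 \<le> b" "real n \<le> 8 * b" "real N \<le> 6 * a"
    and sort: "real S \<le> 180 * (a * b)" and tx: "real tx \<le> c * (real t * a * b)"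
    and T: "T \<le> tx + 2 * (n * (2 * (N * (t + 2)) + t + 6) + 3 * t + 2 * n + 10) + t + 1 + S"
  shows "real T \<le> (1000 + \<bar>c\<bar>) * (real t * a * b)"
proof -
  \<comment> \<open>All three factors are at least 1, so \<open>P\<close> dominates every partial
    product and every constant.\<close>
  define P where "P = real t * a * b"
  have t: "1 \<le> real t"
    using assms(1) by simp
  have "1 * 1 \<le> real t * a" "real t * 1 \<le> real t * a"
    using t assms(2) by (intro mult_mono; simp)+
  then have ta: "1 \<le> real t * a" "real t \<le> real t * a"
    by simp_all
  have "real t * a * 1 \<le> real t * a * b"
    using ta assms(3) by (intro mult_left_mono) auto
  moreover have "1 * (a * b) \<le> real t * (a * b)"
    using t assms(2,3) by (intro mult_right_mono) auto
  moreover have "1 * b \<le> real t * a * b"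
    using ta(1) assms(3) by (intro mult_right_mono) auto
  ultimately have P: "real t * a \<le> P" "a * b \<le> P" "b \<le> P"
    unfolding P_def by (simp_all add: mult.assoc)
  have "real N * (real t + 2) \<le> (6 * a) * (3 * real t)"
    using assms(2,5) t by (intro mult_mono) auto
  also have "\<dots> = 18 * (real t * a)"
    by simp
  finally have "2 * (real N * (real t + 2)) + real t + 6 \<le> 43 * (real t * a)"
    using ta by linarith
  then have "real n * (2 * (real N * (real t + 2)) + real t + 6) \<le> (8 * b) * (43 * (real t * a))"
    using assms(3,4) by (intro mult_mono) auto
  also have "\<dots> = 344 * P"
    by (simp add: P_def mult_ac)
  finally have "real n * (2 * (real N * (real t + 2)) + real t + 6) \<le> 344 * P" .
  moreover define X where "X = real n * (2 * (real N * (real t + 2)) + real t + 6)"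
  ultimately have X: "X \<le> 344 * P"
    by simp
  have bounds: "1 \<le> P" "real t \<le> P" "real n \<le> 8 * P" "real S \<le> 180 * P"
    using P ta assms(4) sort by linarith+
  have "real T \<le> real tx + 2 * (X + 3 * real t + 2 * real n + 10) + real t + 1 + real S"
    unfolding X_def using T by (metis (mono_tags, lifting) of_nat_le_iff of_nat_add of_nat_mult of_nat_numeral of_nat_1)
  \<comment> \<open>The coefficients sum to
    \<open>2 * (344 + 3 + 16 + 10) + 1 + 1 + 180 = 928\<close>.\<close>
  also have "\<dots> \<le> real tx + 1000 * P"
    using bounds X by argo
  also have "real tx \<le> c * P"
    using tx by (simp add: P_def)
  also have "\<dots> \<le> \<bar>c\<bar> * P"
    using bounds(1) by (intro mult_right_mono) auto
  finally show ?thesis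
    by (simp add: P_def algebra_simps)
qed


section \<open>Choice of the budgets and of the common constant\<close>

theorem theorem4p2:
  fixes c :: real
  shows "\<exists>C>0.
    \<forall>(A::int) (B::int) (\<phi>::real \<Rightarrow> real) (\<kappa>::real) (\<epsilon>::real) (xs::real)
      (\<tau>::real \<Rightarrow> nat) (t::nat) (tx::nat) (pick::real \<Rightarrow> real \<Rightarrow> int).
    let D = {real_of_int A..real_of_int B};
        K = 1 + \<epsilon>;
        \<phi>min = phi_min \<phi> D;
        \<phi>max = phi_max \<phi> D;
        time = real t * Olog 2 (\<kappa> * (real_of_int B - real_of_int A) / (\<epsilon> * \<phi>min))
                 * Olog K (\<phi>max / \<phi>min);
        space = Olog 2 (1 / \<epsilon>) + Olog 2 (\<phi>max / \<phi>min) + Olog 2 \<kappa>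
                 + Olog 2 \<bar>real_of_int A\<bar> + Olog 2 \<bar>real_of_int B\<bar>
                 + (if 1 \<le> \<phi>max then 0 else log 2 (1 / \<phi>max));
        run = scaled_compress_conv \<phi> \<tau> \<kappa> pick \<epsilon> (real_of_int A) (real_of_int B) xs tx
    in
      A \<le> B \<longrightarrow> (\<forall>x\<in>D. 0 < \<phi> x) \<longrightarrow> convex_on D \<phi> \<longrightarrow> lipschitz_on \<kappa> D \<phi> \<longrightarrow> 0 < \<kappa> \<longrightarrow>
      0 < \<epsilon> \<longrightarrow>
      1 \<le> t \<longrightarrow> (\<forall>x\<in>D. \<tau> x \<le> t) \<longrightarrow>
      is_arg_min \<phi> (\<lambda>x. x \<in> D) xs \<longrightarrow> real tx \<le> c * time \<longrightarrow>
      picks_integer pick \<longrightarrow>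
        (\<epsilon> \<le> 20 \<longrightarrow> run \<noteq> None) \<and>
        (\<forall>R T. run = Some (R, T) \<longrightarrow>
           (\<exists>E. K_approximation_set K \<phi> (real_of_int A) (real_of_int B) E \<and>
                canonical_representation K \<phi> E R) \<and>
           real (length R) \<le> C * Olog K (\<phi>max / \<phi>min) \<and>
           (\<forall>(x, v) \<in> set R.
              (representable 1 (C * space) x \<or>
               representable (scale_step \<kappa> \<epsilon> \<phi>min) (C * space) x) \<and>
              representable (\<epsilon> * \<phi>min / 10) (C * space) v) \<and>
           real T \<le> C * time)"
\<comment> \<open>The running time dictates the constant, with \<open>\<bar>c\<bar>\<close> paying
  for the minimizer; length and space get by with 18 and 11.\<close>
proof (intro exI[of _ "1000 + \<bar>c\<bar>"] conjI allI, goal_cases)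
  case 1
  show ?case
    by simp
next
  case (2 A B \<phi> \<kappa> \<epsilon> xs \<tau> t tx pick)
  let ?C = "1000 + \<bar>c\<bar>"
  let ?D = "{real_of_int A..real_of_int B}"
  show ?case
    unfolding Let_def
  proof (intro impI)
    assume AB: "A \<le> B" and pos: "\<forall>x\<in>?D. 0 < \<phi> x" and conv: "convex_on ?D \<phi>"
      and lip: "lipschitz_on \<kappa> ?D \<phi>" and \<kappa>: "0 < \<kappa>" and \<epsilon>: "0 < \<epsilon>"
      and t: "1 \<le> t" "\<forall>x\<in>?D. \<tau> x \<le> t" and arg_min: "is_arg_min \<phi> (\<lambda>x. x \<in> ?D) xs"
      and tx: "real tx \<le> c * (real t * Olog 2 (\<kappa> * (real_of_int B - real_of_int A)
                 / (\<epsilon> * phi_min \<phi> ?D)) * Olog (1 + \<epsilon>) (phi_max \<phi> ?D / phi_min \<phi> ?D))"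
      and pick: "picks_integer pick"
    define m where "m = \<phi> xs"
    define M where "M = phi_max \<phi> ?D"
    define X where "X = \<kappa> * (real_of_int B - real_of_int A) / (\<epsilon> * m)"
    define space where "space = Olog 2 (1 / \<epsilon>) + Olog 2 (M / m) + Olog 2 \<kappa>
        + Olog 2 \<bar>real_of_int A\<bar> + Olog 2 \<bar>real_of_int B\<bar> + (if 1 \<le> M then 0 else log 2 (1 / M))"
    have xs: "xs \<in> ?D" and min: "\<And>z. z \<in> ?D \<Longrightarrow> m \<le> \<phi> z"
      using arg_min by (auto simp: is_arg_min_linorder m_def)
    have m: "0 < m" "phi_min \<phi> ?D = m"
      using xs pos min by (auto simp: m_def intro!: phi_min_eq)
    \<comment> \<open>The Lipschitz bound makes the supremum \<open>M\<close> meaningful and also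
      yields \<open>ratio\<close>, which ties the number of pairs to \<open>X\<close> for the
      sorting time.\<close>
    have upper: "\<bar>\<phi> z\<bar> \<le> m + \<kappa> * (real_of_int B - real_of_int A)" if z: "z \<in> ?D" for z
    proof -
      have "dist (\<phi> z) (\<phi> xs) \<le> \<kappa> * dist z xs"
        by (rule lipschitz_onD[OF lip z xs])
      also have "\<kappa> * dist z xs \<le> \<kappa> * (real_of_int B - real_of_int A)"
        using z xs \<kappa> by (intro mult_left_mono) (auto simp: dist_real_def)
      finally show ?thesis
        using min[OF z] m(1) by (simp add: dist_real_def m_def)
    qed
    have \<phi>_le_M: "\<phi> z \<le> M" if "z \<in> ?D" for z
    proof -
      have "\<bar>\<phi> z\<bar> \<le> M"
        unfolding M_def phi_max_def using that upper
        by (intro cSup_upper bdd_aboveI[of _ "m + \<kappa> * (real_of_int B - real_of_int A)"]) auto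
      then show ?thesis
        by simp
    qed
    have "M \<le> m + \<kappa> * (real_of_int B - real_of_int A)"
      unfolding M_def phi_max_def using xs upper by (intro cSup_least) auto
    also have "\<dots> = m * (1 + \<epsilon> * X)"
      using m(1) \<epsilon> by (simp add: X_def field_simps)
    finally have ratio: "M / m \<le> 1 + \<epsilon> * X"
      using m(1) by (simp add: pos_divide_le_eq mult.commute)
    have "m \<le> M"
      using \<phi>_le_M[OF xs] by (simp add: m_def)
    then have ratio1: "1 \<le> M / m"
      using m(1) by simp
    have X: "0 \<le> X"
      using AB m(1) \<kappa> \<epsilon> by (simp add: X_def)
    obtain n where n: "M / m < (1 + 3/10 * \<epsilon>) ^ n" "real n \<le> 8 * Olog (1 + \<epsilon>) (M / m)"
      using exists_power_gt_Olog[OF \<epsilon> ratio1] by blast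
    obtain N where N: "10 * X \<le> 2 ^ N" "real N \<le> 6 * Olog 2 X"
      using exists_power2_ge_Olog[OF X] by blast
    define \<delta> where "\<delta> = (if 1 \<le> M then 0 else log 2 (1 / M))"
    have space: "space = Olog 2 (1 / \<epsilon>) + Olog 2 (M / m) + Olog 2 \<kappa>
        + Olog 2 \<bar>real_of_int A\<bar> + Olog 2 \<bar>real_of_int B\<bar> + \<delta>"
      by (simp only: space_def \<delta>_def)
    have \<delta>: "0 \<le> \<delta>" "log 2 (1 / M) \<le> \<delta>"
      using m(1) \<open>m \<le> M\<close> by (auto simp: \<delta>_def)
    have C: "11 \<le> ?C"
      by simp
    note representable = representable_endpoint[OF \<kappa> \<epsilon> m(1) \<open>m \<le> M\<close> \<delta> C space]
      representable_lattice_point[OF \<kappa> \<epsilon> m(1) \<open>m \<le> M\<close> \<delta> C space]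
      representable_value[OF \<kappa> \<epsilon> m(1) \<open>m \<le> M\<close> \<delta> C space]
    have ends: "real_of_int A \<in> ?D" "real_of_int B \<in> ?D"
      using AB by auto
    have "\<phi> z < (1 + 3/10 * \<epsilon>) ^ n * \<phi> xs" if "z \<in> ?D" for z
      using \<phi>_le_M[OF that] n(1) m(1) by (simp add: m_def pos_divide_less_eq)
    moreover have "10 * \<kappa> * (real_of_int B - real_of_int A) \<le> 2 ^ N * (\<epsilon> * \<phi> xs)"
      using N(1) m(1) \<epsilon> by (simp add: X_def pos_divide_le_eq mult.assoc flip: m_def)
    ultimately have spec: "(\<epsilon> \<le> 20 \<longrightarrow>
        scaled_compress_conv \<phi> \<tau> \<kappa> pick \<epsilon> (real_of_int A) (real_of_int B) xs tx \<noteq> None) \<and>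
      (\<forall>R T. scaled_compress_conv \<phi> \<tau> \<kappa> pick \<epsilon> (real_of_int A) (real_of_int B) xs tx = Some (R, T) \<longrightarrow>
        (\<exists>Z. set R = rounded \<phi> \<epsilon> (\<phi> xs) ` ({real_of_int A, real_of_int B} \<union> Z) \<and>
           sorted_wrt (<) (map fst R) \<and> length R \<le> 2 * n + 2 \<and> finite Z \<and> Z \<subseteq> ?D \<and>
           (\<forall>z\<in>Z. \<exists>k::int. z = scale_step \<kappa> \<epsilon> (\<phi> xs) * of_int k) \<and>
           bracketing (1 + \<epsilon>) \<phi> (real_of_int A) (real_of_int B) ({real_of_int A, real_of_int B} \<union> Z) \<and>
           T \<le> tx + 2 * (n * (2 * (N * (t + 2)) + t + 6) + 3 * t + 2 * n + 10) + t + 1 +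
                (2 * n + 4) * (1 + ceillog2 (2 * n + 4))))"
      using min m(1) t(2) ends unfolding m_def
      by (intro scaled_compress_conv_spec conv lip \<kappa> \<epsilon> xs pick) auto
    show "(\<epsilon> \<le> 20 \<longrightarrow>
        scaled_compress_conv \<phi> \<tau> \<kappa> pick \<epsilon> (real_of_int A) (real_of_int B) xs tx \<noteq> None) \<and>
      (\<forall>R T. scaled_compress_conv \<phi> \<tau> \<kappa> pick \<epsilon> (real_of_int A) (real_of_int B) xs tx = Some (R, T) \<longrightarrow>
           (\<exists>E. K_approximation_set (1 + \<epsilon>) \<phi> (real_of_int A) (real_of_int B) E \<and>
                canonical_representation (1 + \<epsilon>) \<phi> E R) \<and>
           real (length R) \<le> ?C * Olog (1 + \<epsilon>) (phi_max \<phi> ?D / phi_min \<phi> ?D) \<and>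
           (\<forall>(x, v) \<in> set R.
              (representable 1 (?C * (Olog 2 (1 / \<epsilon>) + Olog 2 (phi_max \<phi> ?D / phi_min \<phi> ?D) + Olog 2 \<kappa>
                 + Olog 2 \<bar>real_of_int A\<bar> + Olog 2 \<bar>real_of_int B\<bar>
                 + (if 1 \<le> phi_max \<phi> ?D then 0 else log 2 (1 / phi_max \<phi> ?D)))) x \<or>
               representable (scale_step \<kappa> \<epsilon> (phi_min \<phi> ?D))
                (?C * (Olog 2 (1 / \<epsilon>) + Olog 2 (phi_max \<phi> ?D / phi_min \<phi> ?D) + Olog 2 \<kappa>
                 + Olog 2 \<bar>real_of_int A\<bar> + Olog 2 \<bar>real_of_int B\<bar>
                 + (if 1 \<le> phi_max \<phi> ?D then 0 else log 2 (1 / phi_max \<phi> ?D)))) x) \<and>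
              representable (\<epsilon> * phi_min \<phi> ?D / 10)
                (?C * (Olog 2 (1 / \<epsilon>) + Olog 2 (phi_max \<phi> ?D / phi_min \<phi> ?D) + Olog 2 \<kappa>
                 + Olog 2 \<bar>real_of_int A\<bar> + Olog 2 \<bar>real_of_int B\<bar>
                 + (if 1 \<le> phi_max \<phi> ?D then 0 else log 2 (1 / phi_max \<phi> ?D)))) v) \<and>
           real T \<le> ?C * (real t * Olog 2 (\<kappa> * (real_of_int B - real_of_int A)
                 / (\<epsilon> * phi_min \<phi> ?D)) * Olog (1 + \<epsilon>) (phi_max \<phi> ?D / phi_min \<phi> ?D)))"
      unfolding m(2) M_def[symmetric] space_def[symmetric] X_def[symmetric]
    proof (intro conjI impI allI)
      fix R T
      assume "scaled_compress_conv \<phi> \<tau> \<kappa> pick \<epsilon> (real_of_int A) (real_of_int B) xs tx = Some (R, T)"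
      then obtain Z where R: "set R = rounded \<phi> \<epsilon> m ` ({real_of_int A, real_of_int B} \<union> Z)"
          "sorted_wrt (<) (map fst R)" "length R \<le> 2 * n + 2"
        and Z: "finite Z" "Z \<subseteq> ?D" "\<forall>z\<in>Z. \<exists>k::int. z = scale_step \<kappa> \<epsilon> m * of_int k"
          "bracketing (1 + \<epsilon>) \<phi> (real_of_int A) (real_of_int B) ({real_of_int A, real_of_int B} \<union> Z)"
        and T: "T \<le> tx + 2 * (n * (2 * (N * (t + 2)) + t + 6) + 3 * t + 2 * n + 10) + t + 1 +
                (2 * n + 4) * (1 + ceillog2 (2 * n + 4))"
        using spec unfolding m_def by blast
      let ?E = "{real_of_int A, real_of_int B} \<union> Z"
      have E: "finite ?E" "?E \<subseteq> ?D"
        using Z(1,2) ends by auto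
      have "K_approximation_set (1 + \<epsilon>) \<phi> (real_of_int A) (real_of_int B) ?E"
        by (rule K_approximation_set_if_bracketing[OF conv E _ _ Z(4)]) auto
      moreover have "canonical_representation (1 + \<epsilon>) \<phi> ?E R"
        unfolding canonical_representation_def
      proof (intro conjI R(2))
        show "fst ` set R = ?E"
          unfolding R(1) rounded_def by (simp add: image_image)
        \<comment> \<open>Rounding up adds at most one unit \<open>\<epsilon> * m / 10\<close>, well
          within the allowed error \<open>\<epsilon> * \<phi> z\<close>.\<close>
        have "\<phi> z \<le> \<epsilon> * m / 10 * of_int \<lceil>10 * \<phi> z / (\<epsilon> * m)\<rceil> \<and>
            \<epsilon> * m / 10 * of_int \<lceil>10 * \<phi> z / (\<epsilon> * m)\<rceil> \<le> (1 + \<epsilon>) * \<phi> z" if z: "z \<in> ?E" for z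
        proof -
          have unit: "0 < \<epsilon> * m / 10"
            using \<epsilon> m(1) by simp
          have "\<phi> z = \<epsilon> * m / 10 * (10 * \<phi> z / (\<epsilon> * m))"
            using \<epsilon> m(1) by simp
          also have "\<dots> \<le> \<epsilon> * m / 10 * of_int \<lceil>10 * \<phi> z / (\<epsilon> * m)\<rceil>"
            using unit by (intro mult_left_mono) auto
          finally have "\<phi> z \<le> \<epsilon> * m / 10 * of_int \<lceil>10 * \<phi> z / (\<epsilon> * m)\<rceil>" .
          moreover have "\<epsilon> * m / 10 * of_int \<lceil>10 * \<phi> z / (\<epsilon> * m)\<rceil>
              \<le> \<epsilon> * m / 10 * (10 * \<phi> z / (\<epsilon> * m) + 1)"
            using unit by (intro mult_left_mono) linarith+
          moreover have "\<epsilon> * m / 10 * (10 * \<phi> z / (\<epsilon> * m) + 1) = \<phi> z + \<epsilon> * m / 10"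
            using \<epsilon> m(1) by (simp add: distrib_left)
          moreover have "\<epsilon> * m \<le> \<epsilon> * \<phi> z"
            using min[of z] z E(2) \<epsilon> by (intro mult_left_mono) auto
          moreover have "0 < \<epsilon> * m" "(1 + \<epsilon>) * \<phi> z = \<phi> z + \<epsilon> * \<phi> z"
            using \<epsilon> m(1) by (simp_all add: distrib_right)
          ultimately show ?thesis
            by linarith
        qed
        then show "\<forall>(x, v)\<in>set R. \<phi> x \<le> v \<and> v \<le> (1 + \<epsilon>) * \<phi> x"
          unfolding R(1) rounded_def by blast
      qed
      ultimately show "\<exists>E. K_approximation_set (1 + \<epsilon>) \<phi> (real_of_int A) (real_of_int B) E \<and>
          canonical_representation (1 + \<epsilon>) \<phi> E R"
        by blast
      \<comment> \<open>\<open>2 * n + 2\<close> with \<open>n\<close> at most 8 logarithms, each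
        logarithm being at least 1.\<close>
      have "real (length R) \<le> 18 * Olog (1 + \<epsilon>) (M / m)"
        using R(3) n(2) Olog_ge_1[of "1 + \<epsilon>" "M / m"] by linarith
      also have "\<dots> \<le> ?C * Olog (1 + \<epsilon>) (M / m)"
        using Olog_ge_1[of "1 + \<epsilon>" "M / m"] by (intro mult_right_mono) auto
      finally show "real (length R) \<le> ?C * Olog (1 + \<epsilon>) (M / m)" .
      have "(representable 1 (?C * space) z \<or> representable (scale_step \<kappa> \<epsilon> m) (?C * space) z) \<and>
          representable (\<epsilon> * m / 10) (?C * space) (\<epsilon> * m / 10 * of_int \<lceil>10 * \<phi> z / (\<epsilon> * m)\<rceil>)"
        if z: "z \<in> ?E" for z
      proof
        have zD: "z \<in> ?D"
          using z E(2) by blast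
        show "representable (\<epsilon> * m / 10) (?C * space) (\<epsilon> * m / 10 * of_int \<lceil>10 * \<phi> z / (\<epsilon> * m)\<rceil>)"
          using pos zD \<phi>_le_M[OF zD] by (intro representable(3)) (auto intro: less_imp_le)
        show "representable 1 (?C * space) z \<or> representable (scale_step \<kappa> \<epsilon> m) (?C * space) z"
        proof (cases "z \<in> Z")
          case True
          then obtain k :: int where "z = scale_step \<kappa> \<epsilon> m * of_int k"
            using Z(3) by blast
          then show ?thesis
            using representable(2) zD by simp
        next
          case False
          then have "z = of_int A \<or> z = of_int B"
            using z by simp
          then show ?thesis
            using representable(1) by blast
        qed
      qed
      then show "\<forall>(x, v)\<in>set R.
          (representable 1 (?C * space) x \<or> representable (scale_step \<kappa> \<epsilon> m) (?C * space) x) \<and>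
          representable (\<epsilon> * m / 10) (?C * space) v"
        unfolding R(1) rounded_def by blast
      have "real (2 * n + 4) \<le> 20 * Olog (1 + \<epsilon>) (M / m)"
        using n(2) Olog_ge_1[of "1 + \<epsilon>" "M / m"] by simp
      then have "real ((2 * n + 4) * (1 + ceillog2 (2 * n + 4)))
          \<le> 180 * (Olog 2 X * Olog (1 + \<epsilon>) (M / m))"
        by (intro sort_bound[OF \<epsilon> ratio1 ratio]) (use X in simp_all)
      then show "real T \<le> ?C * (real t * Olog 2 X * Olog (1 + \<epsilon>) (M / m))"
        by (rule time_bound[OF t(1) Olog_ge_1 Olog_ge_1 n(2) N(2) _ _ T])
          (use tx in \<open>simp add: m(2) M_def X_def\<close>)
    qed (use spec in blast)
  qed
qed

end
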